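(* Let $\boldsymbol{a}\in\mathbb{Z}^3\setminus\{\boldsymbol{0}\}$, let $M$ be an integer, and let $\theta\in(0,\pi)$, $\theta\neq\pi/2$, be such that $\tan^2\theta$ is rational. Let $N$ denote the square-free part of $\tan^2\theta$. (1) If $\|\boldsymbol{a}\|^2=M^2$, then $\theta\in\Theta_3(\boldsymbol{a})$ if and only if $N$ is of the form $2^b p_1\cdots p_s$ with $p_i\equiv 1\pmod 4$ for all $i$. (2) If $\|\boldsymbol{a}\|^2=2M^2$, then $\theta\in\Theta_3(\boldsymbol{a})$ if and only if $N$ is of the form $2^b p_1\cdots p_s$ with $p_i\equiv 1$ or $3\pmod 8$ for all $i$. (3) Suppose $\|\boldsymbol{a}\|^2=qM^2$ where $q$ is an odd prime. (a) If $q\equiv 3\pmod 8$, then $\theta\in\Theta_3(\boldsymbol{a})$ if and only if $N$ is of the form $2q^{b'}p_1\cdots p_s$ with $\left(\frac{p_i}{q}\right)=1$ for $i=1,\ldots,s$. (b) If $q\equiv 1\pmod 8$, then $\theta\in\Theta_3(\boldsymbol{a})$ if and only if $N$ is of the form $2^b q^{b'}p_1\cdots p_s$ with $\left(\frac{p_i}{q}\right)=(-1)^{(p_i-1)/2}$ for $i=1,\ldots,s$ and $(p_1\cdots p_s-1)/2$ even. (c) If $q\equiv 5\pmod 8$, then $\theta\in\Theta_3(\boldsymbol{a})$ if and only if either $N$ is of the form $q^{b'}p_1\cdots p_s$ with $\left(\frac{p_i}{q}\right)=(-1)^{(p_i-1)/2}$ for $i=1,\ldots,s$ and $(p_1\cdots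 p_s-1)/2$ even, or $N$ is of the form $2q^{b'}p_1\cdots p_s$ with $\left(\frac{p_i}{q}\right)=(-1)^{(p_i-1)/2}$ for $i=1,\ldots,s$ and $(p_1\cdots p_s-1)/2$ odd. (The case $q\equiv 7\pmod 8$ does not occur, since $\|\boldsymbol{a}\|^2$ is a sum of three integer squares.) Here, in each "of the form" condition, $b,b'\in\{0,1\}$, $s\ge 0$, and $p_1,\ldots,p_s$ are odd primes, with $p_1\cdots p_s=1$ when $s=0$.
   Context: For nonzero $\boldsymbol{a},\boldsymbol{b}\in\mathbb{R}^3$, $\angle(\boldsymbol{a},\boldsymbol{b}):=\arccos\dfrac{\boldsymbol{a}\cdot\boldsymbol{b}}{\|\boldsymbol{a}\|\,\|\boldsymbol{b}\|}\in[0,\pi]$, with the standard scalar product and Euclidean norm. For $\boldsymbol{a}\in\mathbb{Z}^3\setminus\{\boldsymbol{0}\}$, $\Theta_3(\boldsymbol{a}):=\{\angle(\boldsymbol{a},\boldsymbol{b})\mid \boldsymbol{b}\in\mathbb{Z}^3\setminus\{\boldsymbol{0}\}\}$; for every $\theta\in\Theta_3(\boldsymbol{a})\setminus\{\pi/2\}$ the number $\tan^2\theta$ is rational. The square-free part of a positive rational number $X$ is the minimum positive integer $N$ such that $X/N$ is the square of a rational number (e.g. the square-free part of $1/4$ is $1$ and that of $5/12$ is $15$). $\left(\frac{\cdot}{q}\right)$ is the Legendre symbol. *)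

theory Defs
  imports "HOL-Analysis.Analysis" "HOL-Number_Theory.Number_Theory"
begin

definition real_vec :: "int ^ 'n \<Rightarrow> real ^ 'n" where
  "real_vec a = (\<chi> i. real_of_int (a $ i))"

text \<open>Only meaningful for nonzero vectors; the library conventions give \<open>arccos 0\<close> otherwise.\<close>

definition vec_angle :: "real ^ 'n \<Rightarrow> real ^ 'n \<Rightarrow> real" where
  "vec_angle a b = arccos ((a \<bullet> b) / (norm a * norm b))"

definition Theta3 :: "int ^ 3 \<Rightarrow> real set" where
  "Theta3 a = {vec_angle (real_vec a) (real_vec b) | b. b \<noteq> 0}"

text \<open>The square-free part of a positive rational number, here given as a real number
  (\<open>\<rat>\<close> is the set of rational reals). For arguments that are not positive rationals the
  value is not meaningful. It differs from \<open>squarefree_part\<close> of the library, which is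
  defined on factorial semirings and is trivial on fields.\<close>

definition rat_squarefree_part :: "real \<Rightarrow> nat" where
  "rat_squarefree_part X = (LEAST N. N > 0 \<and> (\<exists>r\<in>\<rat>. X / real N = r\<^sup>2))"

end

theory Submission
  imports Defs "HOL-Computational_Algebra.Squarefree"
begin

text \<open>
  An angle \<open>\<theta>\<close> belongs to \<open>\<Theta>\<^sub>3(a)\<close> iff some rational vector orthogonal to \<open>a\<close> has squared length
  \<open>N\<close>. If \<open>\<parallel>a\<parallel>\<^sup>2 = q M\<^sup>2\<close>, then a reflection carries \<open>a\<close> to any other rational vector of the same
  length, so the quadratic form on the orthogonal plane depends only on \<open>q\<close>. Since \<open>q\<close> is of the
  form \<open>x\<^sup>2 + y\<^sup>2\<close>, or of the form \<open>x\<^sup>2 + 2y\<^sup>2\<close> if \<open>q \<equiv> 3\<close> modulo \<open>8\<close>, with rational \<open>x\<close>, \<open>y\<close>, one may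
  choose a convenient vector and finds that \<open>\<theta>\<close> belongs to \<open>\<Theta>\<^sub>3(a)\<close> iff \<open>N\<close>, respectively \<open>2N\<close>, is
  represented by \<open>x\<^sup>2 + q y\<^sup>2\<close> over the rationals. This is decided by Legendre's theorem on ternary
  forms, whose conditions on the prime divisors of \<open>N\<close> are restated by quadratic reciprocity.
\<close>

section \<open>Rational norms\<close>

text \<open>This is \<open>n = x\<^sup>2 + k y\<^sup>2\<close> with rational \<open>x\<close> and \<open>y\<close>, cleared of denominators; if \<open>-k\<close> is not
  a square, then \<open>n\<close> is a norm from the field obtained by adjoining a square root of \<open>-k\<close>.\<close>

definition is_rat_norm :: "int \<Rightarrow> int \<Rightarrow> bool" where
  "is_rat_norm k n \<longleftrightarrow> (\<exists>x y z. z \<noteq> 0 \<and> x\<^sup>2 + k * y\<^sup>2 = n * z\<^sup>2)"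

text \<open>Brahmagupta's identity: the norm form \<open>x^2 + k y^2\<close> is multiplicative, and
  the denominators multiply along.\<close>

lemma is_rat_norm_mult:
  assumes "is_rat_norm k m" "is_rat_norm k n"
  shows "is_rat_norm k (m * n)"
proof -
  obtain x y z where 1: "z \<noteq> 0" "x\<^sup>2 + k * y\<^sup>2 = m * z\<^sup>2"
    using assms(1) by (auto simp: is_rat_norm_def)
  obtain x' y' z' where 2: "z' \<noteq> 0" "x'\<^sup>2 + k * y'\<^sup>2 = n * z'\<^sup>2"
    using assms(2) by (auto simp: is_rat_norm_def)
  have "(x * x' - k * y * y')\<^sup>2 + k * (x * y' + y * x')\<^sup>2 = (x\<^sup>2 + k * y\<^sup>2) * (x'\<^sup>2 + k * y'\<^sup>2)"
    by (simp add: power2_eq_square algebra_simps)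
  also have "\<dots> = m * n * (z * z')\<^sup>2"
    unfolding 1 2 by (simp add: power_mult_distrib mult_ac)
  finally show ?thesis
    using 1 2 unfolding is_rat_norm_def by (metis mult_eq_0_iff)
qed

lemma is_rat_norm_mult_square_iff:
  assumes "c \<noteq> 0"
  shows "is_rat_norm k (n * c\<^sup>2) \<longleftrightarrow> is_rat_norm k n"
proof
  assume "is_rat_norm k (n * c\<^sup>2)"
  then obtain x y z where "z \<noteq> 0" "x\<^sup>2 + k * y\<^sup>2 = n * (c * z)\<^sup>2"
    by (auto simp: is_rat_norm_def power_mult_distrib mult.assoc)
  then show "is_rat_norm k n"
    using assms unfolding is_rat_norm_def by (metis mult_eq_0_iff)
next
  assume "is_rat_norm k n"
  moreover have "is_rat_norm k (c\<^sup>2)"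
    unfolding is_rat_norm_def by (intro exI[of _ c] exI[of _ 0] exI[of _ 1]) simp
  ultimately show "is_rat_norm k (n * c\<^sup>2)"
    by (rule is_rat_norm_mult)
qed

lemma is_rat_norm_one [simp]: "is_rat_norm k 1"
  unfolding is_rat_norm_def by (intro exI[of _ 1] exI[of _ 0]) simp

lemma is_rat_norm_self [simp]: "is_rat_norm k k"
  unfolding is_rat_norm_def by (intro exI[of _ 0] exI[of _ 1]) simp

text \<open>Multiplying \<open>n * m\<close> by the norm \<open>m\<close> once more gives
  \<open>n\<close> times a square, and square factors do not matter.\<close>

lemma is_rat_norm_mult_cancel:
  assumes "is_rat_norm k m" "m \<noteq> 0"
  shows "is_rat_norm k (n * m) \<longleftrightarrow> is_rat_norm k n"
proof
  assume "is_rat_norm k (n * m)"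
  then have "is_rat_norm k (n * m * m)"
    using assms(1) by (rule is_rat_norm_mult)
  then show "is_rat_norm k n"
    using is_rat_norm_mult_square_iff[OF assms(2)] by (simp add: power2_eq_square mult.assoc)
next
  assume "is_rat_norm k n"
  then show "is_rat_norm k (n * m)"
    using assms(1) by (rule is_rat_norm_mult)
qed

lemma is_rat_norm_prod_list:
  "(\<And>n. n \<in> set ns \<Longrightarrow> is_rat_norm k n) \<Longrightarrow> is_rat_norm k (prod_list ns)"
  by (induction ns) (auto intro: is_rat_norm_mult)

section \<open>Sufficient conditions for norms: small solutions by pigeonhole\<close>

lemma strict_sqrt_bound:
  fixes m :: int
  assumes "m > 0"
  obtains r :: int where "r \<ge> 0" "r\<^sup>2 < m" "m \<le> (r + 1)\<^sup>2"
proof -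
  have "\<exists>r::nat. m \<le> int (Suc r)^2"
  proof
    have "m * 1 \<le> (m + 1) * (m + 1)"
      using assms by (intro mult_mono) auto
    then show "m \<le> int (Suc (nat m))^2"
      using assms by (simp add: power2_eq_square algebra_simps)
  qed
  define r where "r = (LEAST r::nat. m \<le> int (Suc r)^2)"
  have 1: "m \<le> int (Suc r)^2"
    unfolding r_def by (rule LeastI_ex) fact
  have 2: "int r ^ 2 < m"
  proof (cases r)
    case 0
    then show ?thesis using assms by simp
  next
    case (Suc r')
    then have "\<not> m \<le> int (Suc r')^2"
      using not_less_Least[of r' "\<lambda>r. m \<le> int (Suc r)^2"] unfolding r_def by simp
    then show ?thesis using Suc by simp
  qed
  show ?thesis
    using that[of "int r"] 1 2 by (simp add: add.commute)
qed

lemma abs_diff_power2_le: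
  fixes u v :: int
  assumes "0 \<le> u" "u \<le> b" "0 \<le> v" "v \<le> b"
  shows "(u - v)\<^sup>2 \<le> b\<^sup>2"
  using assms by (subst abs_le_square_iff[symmetric]) auto

text \<open>By the pigeonhole principle there are small \<open>x\<close>, \<open>y\<close>, \<open>z\<close>, not all zero, with
  \<open>x \<equiv> s y\<close> modulo \<open>n\<close> and \<open>x \<equiv> t z\<close> modulo \<open>k\<close>, so that \<open>x\<^sup>2 + k y\<^sup>2 - n z\<^sup>2\<close> is a multiple of
  \<open>k n\<close> of size forcing it to be \<open>0\<close> or \<open>k n\<close>. In the second case \<open>n (z\<^sup>2 + k)\<close> is a norm, and so is
  its factor \<open>z\<^sup>2 + k\<close>.\<close>

lemma is_rat_norm_if_QuadRes:
  fixes k n :: int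
  assumes pos: "k > 0" "n > 0" and coprime: "coprime k n"
    and nonsquare: "\<And>c. k * n \<noteq> c\<^sup>2"
    and "QuadRes n (- k)" "QuadRes k n"
  shows "is_rat_norm k n"
proof -
  obtain s where s: "[s\<^sup>2 = - k] (mod n)" using assms by (auto simp: QuadRes_def)
  obtain t where t: "[t\<^sup>2 = n] (mod k)" using assms by (auto simp: QuadRes_def)
  have kn: "k * n > 0" using pos by simp
  \<comment> \<open>Each of \<open>X\<close>, \<open>Y\<close>, \<open>Z\<close> is the largest
    integer strictly below a square root. Differences within \<open>{0..X}\<close> thus stay
    strictly below the root, while the \<open>X + 1\<close> points of this range number at least the
    root; likewise for \<open>Y\<close> and \<open>Z\<close>.\<close>
  obtain X where X: "X \<ge> 0" "X\<^sup>2 < k * n" "k * n \<le> (X + 1)\<^sup>2" using strict_sqrt_bound[OF kn] .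
  obtain Y where Y: "Y \<ge> 0" "Y\<^sup>2 < n" "n \<le> (Y + 1)\<^sup>2" using strict_sqrt_bound[OF pos(2)] .
  obtain Z where Z: "Z \<ge> 0" "Z\<^sup>2 < k" "k \<le> (Z + 1)\<^sup>2" using strict_sqrt_bound[OF pos(1)] .
  define box where "box = {0..X} \<times> {0..Y} \<times> {0..Z}"
  define f where "f = (\<lambda>(x, y, z). ((x - s * y) mod n, (x - t * z) mod k))"
  have "(k * n)\<^sup>2 < ((X + 1) * (Y + 1) * (Z + 1))\<^sup>2"
  proof -
    \<comment> \<open>This is where strictness enters: equality is excluded because
      \<open>k * n\<close> is not a square. It makes the box larger than the set of residue
      pairs.\<close>
    have "k * n < (X + 1)\<^sup>2" using X(3) nonsquare[of "X + 1"] by simp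
    moreover have "k * n \<le> (Y + 1)\<^sup>2 * (Z + 1)\<^sup>2"
      using Y(3) Z(3) pos mult_mono[of n "(Y+1)\<^sup>2" k "(Z+1)\<^sup>2"] by (simp add: mult.commute)
    ultimately have "(k * n) * (k * n) < (X + 1)\<^sup>2 * ((Y + 1)\<^sup>2 * (Z + 1)\<^sup>2)"
      using kn by (intro mult_less_le_imp_less) auto
    then show ?thesis by (simp add: power_mult_distrib power2_eq_square mult_ac)
  qed
  then have "k * n < (X + 1) * (Y + 1) * (Z + 1)"
    by (rule power_less_imp_less_base) (use X Y Z in simp)
  then have card_lt: "nat (n * k) < card box"
    using X Y Z unfolding box_def card_cartesian_product
    by (simp add: nat_mult_distrib[symmetric] nat_less_eq_zless mult_ac add.commute)
  have "f ` box \<subseteq> {0..<n} \<times> {0..<k}"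
    using pos by (auto simp: f_def)
  then have "card (f ` box) \<le> card ({0..<n} \<times> {0..<k})"
    by (intro card_mono) auto
  also have "\<dots> = nat (n * k)"
    using pos unfolding card_cartesian_product by (simp add: nat_mult_distrib)
  finally have "\<not> inj_on f box"
    using card_lt by (intro pigeonhole) simp
  then obtain x1 y1 z1 x2 y2 z2 where
    in_box: "(x1, y1, z1) \<in> box" "(x2, y2, z2) \<in> box" and
    ne: "(x1, y1, z1) \<noteq> (x2, y2, z2)" and eq: "f (x1, y1, z1) = f (x2, y2, z2)"
    unfolding inj_on_def by (metis prod_cases3)
  define x where "x = x1 - x2"
  define y where "y = y1 - y2"
  define z where "z = z1 - z2"
  have nz: "x \<noteq> 0 \<or> y \<noteq> 0 \<or> z \<noteq> 0" using ne by (auto simp: x_def y_def z_def)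
  have bounds: "x\<^sup>2 < k * n" "y\<^sup>2 < n" "z\<^sup>2 < k"
    using in_box X(2) Y(2) Z(2) abs_diff_power2_le[of x1 X x2] abs_diff_power2_le[of y1 Y y2]
      abs_diff_power2_le[of z1 Z z2]
    unfolding box_def x_def y_def z_def by auto
  have "n dvd (x1 - s * y1) - (x2 - s * y2)" "k dvd (x1 - t * z1) - (x2 - t * z2)"
    using eq by (auto simp: f_def mod_eq_dvd_iff)
  then have "n dvd x - s * y" "k dvd x - t * z"
    by (simp_all add: x_def y_def z_def algebra_simps)
  define Q where "Q = x\<^sup>2 + k * y\<^sup>2 - n * z\<^sup>2"
  have "n dvd Q"
  proof -
    have "n dvd s\<^sup>2 + k" using s by (simp add: cong_iff_dvd_diff)
    moreover have "Q = (x - s * y) * (x + s * y) + (s\<^sup>2 + k) * y\<^sup>2 - n * z\<^sup>2"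
      by (simp add: Q_def power2_eq_square algebra_simps)
    ultimately show ?thesis using \<open>n dvd x - s * y\<close> by simp
  qed
  moreover have "k dvd Q"
  proof -
    have "k dvd t\<^sup>2 - n" using t by (simp add: cong_iff_dvd_diff)
    moreover have "Q = (x - t * z) * (x + t * z) + (t\<^sup>2 - n) * z\<^sup>2 + k * y\<^sup>2"
      by (simp add: Q_def power2_eq_square algebra_simps)
    ultimately show ?thesis using \<open>k dvd x - t * z\<close> by simp
  qed
  ultimately have "k * n dvd Q"
    using coprime by (simp add: divides_mult)
  then obtain c where c: "Q = k * n * c" by blast
  have "k * y\<^sup>2 < k * n" "n * z\<^sup>2 < n * k"
    using bounds pos by simp_all
  then have "Q < k * n * 2" "Q > k * n * (-1)"
  proof -
    have "0 \<le> x\<^sup>2" "0 \<le> k * y\<^sup>2" "0 \<le> n * z\<^sup>2" using pos by simp_all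
    then show "Q < k * n * 2" "Q > k * n * (-1)"
      using bounds(1) \<open>k * y\<^sup>2 < k * n\<close> \<open>n * z\<^sup>2 < n * k\<close> unfolding Q_def mult.commute[of n k]
      by linarith+
  qed
  then have "c < 2" "c > -1"
    unfolding c using kn mult_less_cancel_left_pos by blast+
  then consider "c = 0" | "c = 1" by linarith
  then show ?thesis
  proof cases
    case 1
    then have eq0: "x\<^sup>2 + k * y\<^sup>2 = n * z\<^sup>2" using c by (simp add: Q_def)
    have "z \<noteq> 0"
    proof
      assume "z = 0"
      then have "x\<^sup>2 + k * y\<^sup>2 = 0" using eq0 by simp
      moreover have "x\<^sup>2 \<ge> 0" "k * y\<^sup>2 \<ge> 0" using pos by simp_all
      ultimately have "x\<^sup>2 = 0" "k * y\<^sup>2 = 0" by linarith+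
      then show False using nz pos \<open>z = 0\<close> by simp
    qed
    then show ?thesis using eq0 unfolding is_rat_norm_def by blast
  next
    case 2
    then have eq1: "x\<^sup>2 + k * y\<^sup>2 = n * (z\<^sup>2 + k)" using c by (simp add: Q_def algebra_simps)
    have "z\<^sup>2 + k > 0" using pos by (simp add: add_nonneg_pos)
    moreover have "is_rat_norm k (z\<^sup>2 + k)"
      unfolding is_rat_norm_def by (intro exI[of _ z] exI[of _ 1]) simp
    moreover have "is_rat_norm k (n * (z\<^sup>2 + k))"
      unfolding is_rat_norm_def eq1[symmetric]
      by (intro exI[of _ x] exI[of _ y] exI[of _ 1]) simp
    ultimately show ?thesis
      using is_rat_norm_mult_cancel[of k "z\<^sup>2 + k" n] by simp
  qed
qed

section \<open>Necessary conditions for norms at a single prime\<close>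

lemma is_rat_norm_primitive:
  fixes p :: int
  assumes "is_rat_norm k n" "prime p"
  obtains x y z where "z \<noteq> 0" "x\<^sup>2 + k * y\<^sup>2 = n * z\<^sup>2" "\<not> (p dvd x \<and> p dvd y \<and> p dvd z)"
proof -
  obtain x y z where "z \<noteq> 0" "x\<^sup>2 + k * y\<^sup>2 = n * z\<^sup>2"
    using assms(1) unfolding is_rat_norm_def by blast
  then have "\<exists>x y z. z \<noteq> 0 \<and> x\<^sup>2 + k * y\<^sup>2 = n * z\<^sup>2 \<and> \<not> (p dvd x \<and> p dvd y \<and> p dvd z)"
  \<comment> \<open>Descent: a common factor \<open>p\<close> can be divided out of all three
    numbers, which makes \<open>\<bar>z\<bar>\<close> smaller.\<close>
  proof (induction "nat \<bar>z\<bar>" arbitrary: x y z rule: less_induct)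
    case less
    show ?case
    proof (cases "p dvd x \<and> p dvd y \<and> p dvd z")
      case True
      then obtain x' y' z' where *: "x = p * x'" "y = p * y'" "z = p * z'" by blast
      have "p > 1" using assms(2) by (simp add: prime_gt_1_int)
      have "z' \<noteq> 0" using * less.prems by auto
      have "p\<^sup>2 * (x'\<^sup>2 + k * y'\<^sup>2) = p\<^sup>2 * (n * z'\<^sup>2)"
        using less.prems(2) by (simp add: * power_mult_distrib algebra_simps)
      then have "x'\<^sup>2 + k * y'\<^sup>2 = n * z'\<^sup>2"
        using \<open>p > 1\<close> by simp
      moreover have "1 * \<bar>z'\<bar> < p * \<bar>z'\<bar>"
        using \<open>p > 1\<close> \<open>z' \<noteq> 0\<close> by (intro mult_strict_right_mono) auto
      then have "nat \<bar>z'\<bar> < nat \<bar>z\<bar>"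
        using \<open>p > 1\<close> by (simp add: * abs_mult)
      ultimately show ?thesis using less.hyps[of z' x' y'] \<open>z' \<noteq> 0\<close> by blast
    qed (use less.prems in blast)
  qed
  then show ?thesis using that by blast
qed

text \<open>Take a solution that is primitive at \<open>p\<close>. If \<open>p\<close> divided
  \<open>y\<close>, it would divide \<open>x\<close>, and since \<open>p\<close> divides
  \<open>n\<close> only once also \<open>z\<close>. So \<open>y\<close> is invertible modulo
  \<open>p\<close>, and \<open>x^2 = - k y^2\<close> modulo \<open>p\<close> can be divided by
  \<open>y^2\<close>.\<close>

lemma QuadRes_neg_if_is_rat_norm:
  fixes p :: int
  assumes norm: "is_rat_norm k n" and p: "prime p" and dvd: "p dvd n" "\<not> p\<^sup>2 dvd n" "\<not> p dvd k"
  shows "QuadRes p (- k)"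
proof -
  obtain x y z where xyz: "x\<^sup>2 + k * y\<^sup>2 = n * z\<^sup>2" "\<not> (p dvd x \<and> p dvd y \<and> p dvd z)"
    using is_rat_norm_primitive[OF norm p] by metis
  have "\<not> p dvd y"
  proof
    assume "p dvd y"
    then have "p dvd k * y\<^sup>2" by (simp add: power2_eq_square)
    moreover have "p dvd x\<^sup>2 + k * y\<^sup>2" using xyz dvd by simp
    ultimately have "p dvd x\<^sup>2" using dvd_add_left_iff by blast
    then have "p dvd x" using p prime_dvd_power by blast
    then obtain x' y' where "x = p * x'" "y = p * y'" using \<open>p dvd y\<close> by blast
    then have "n * z\<^sup>2 = p\<^sup>2 * (x'\<^sup>2 + k * y'\<^sup>2)"
      using xyz(1) by (simp add: power_mult_distrib algebra_simps)
    moreover obtain n' where n': "n = p * n'" using dvd by blast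
    ultimately have "p * (n' * z\<^sup>2) = p * (p * (x'\<^sup>2 + k * y'\<^sup>2))" by (simp add: power2_eq_square algebra_simps)
    then have "n' * z\<^sup>2 = p * (x'\<^sup>2 + k * y'\<^sup>2)" using p by (metis mult_cancel_left not_prime_0)
    then have "p dvd n' * z\<^sup>2" by simp
    moreover have "\<not> p dvd n'" using dvd(2) n' by (auto simp: power2_eq_square)
    ultimately have "p dvd z" using p by (metis prime_dvd_mult_iff prime_dvd_power)
    then show False using \<open>p dvd x\<close> \<open>p dvd y\<close> xyz by blast
  qed
  then have "coprime y p" using p by (simp add: coprime_commute prime_imp_coprime)
  then obtain y' where y': "[y * y' = 1] (mod p)" using cong_solve_coprime_int by blast
  have "(x * y')\<^sup>2 = n * (z * y')\<^sup>2 - k * (y * y')\<^sup>2"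
    using arg_cong[OF xyz(1), of "\<lambda>u. u * y'\<^sup>2"] by (simp add: algebra_simps power_mult_distrib)
  also have "[n * (z * y')\<^sup>2 - k * (y * y')\<^sup>2 = 0 * (z * y')\<^sup>2 - k * 1\<^sup>2] (mod p)"
    using dvd y' by (intro cong_diff cong_mult cong_pow cong_refl) (simp_all add: cong_0_iff)
  finally show ?thesis unfolding QuadRes_def by auto
qed

text \<open>The counterpart at the prime \<open>q\<close> of the form itself: modulo
  \<open>q\<close> the equation reads \<open>x^2 = n z^2\<close>, and primitivity makes
  \<open>z\<close> invertible.\<close>

lemma QuadRes_if_is_rat_norm_prime:
  fixes q :: int
  assumes norm: "is_rat_norm q n" and q: "prime q" and "\<not> q dvd n"
  shows "QuadRes q n"
proof -
  obtain x y z where xyz: "x\<^sup>2 + q * y\<^sup>2 = n * z\<^sup>2" "\<not> (q dvd x \<and> q dvd y \<and> q dvd z)"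
    using is_rat_norm_primitive[OF norm q] by metis
  have "\<not> q dvd z"
  proof
    assume "q dvd z"
    then have "q dvd n * z\<^sup>2" by (simp add: power2_eq_square)
    then have "q dvd x\<^sup>2" using xyz(1) by (metis dvd_add_left_iff dvd_triv_left)
    then have "q dvd x" using q prime_dvd_power by blast
    then obtain x' z' where "x = q * x'" "z = q * z'" using \<open>q dvd z\<close> by blast
    then have "q * y\<^sup>2 = q * (q * (n * z'\<^sup>2 - x'\<^sup>2))"
      using xyz(1) by (simp add: power2_eq_square algebra_simps)
    then have "y\<^sup>2 = q * (n * z'\<^sup>2 - x'\<^sup>2)" using q by (metis mult_cancel_left not_prime_0)
    then have "q dvd y" using q by (metis dvd_triv_left prime_dvd_power)
    then show False using \<open>q dvd x\<close> \<open>q dvd z\<close> xyz by blast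
  qed
  then have "coprime z q" using q by (simp add: coprime_commute prime_imp_coprime)
  then obtain z' where z': "[z * z' = 1] (mod q)" using cong_solve_coprime_int by blast
  have "(x * z')\<^sup>2 = n * (z * z')\<^sup>2 - q * (y * z')\<^sup>2"
    using arg_cong[OF xyz(1), of "\<lambda>u. u * z'\<^sup>2"] by (simp add: algebra_simps power_mult_distrib)
  also have "[n * (z * z')\<^sup>2 - q * (y * z')\<^sup>2 = n * 1\<^sup>2 - 0 * (y * z')\<^sup>2] (mod q)"
    using z' by (intro cong_diff cong_mult cong_pow cong_refl) (simp_all add: cong_0_iff)
  finally show ?thesis unfolding QuadRes_def by auto
qed

section \<open>Legendre symbols and quadratic residues\<close>

lemma Legendre_range: "Legendre a p \<in> {-1, 0, 1}"
  by (simp add: Legendre_def)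

text \<open>Lifts congruences such as Euler's criterion to equalities between values of Legendre
  symbols: two of these values differ by at most 2, less than the modulus.\<close>

lemma sign_eq_if_cong:
  fixes u v m :: int
  assumes "[u = v] (mod m)" "u \<in> {-1, 0, 1}" "v \<in> {-1, 0, 1}" "m > 2"
  shows "u = v"
proof -
  have "m dvd u - v" using assms(1) by (simp add: cong_iff_dvd_diff)
  moreover have "\<bar>u - v\<bar> \<le> 2"
  proof -
    have "\<bar>u\<bar> \<le> 1" "\<bar>v\<bar> \<le> 1" using assms(2,3) by auto
    then show ?thesis by linarith
  qed
  ultimately have "\<not> \<bar>m\<bar> \<le> \<bar>u - v\<bar>"
    using assms(4) by linarith
  then have "u - v = 0"
    using dvd_imp_le_int[OF _ \<open>m dvd u - v\<close>] by blast
  then show ?thesis by simp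
qed

lemma Legendre_mult:
  fixes p :: nat
  assumes "prime p" "2 < p"
  shows "Legendre (a * b) (int p) = Legendre a (int p) * Legendre b (int p)"
proof (rule sign_eq_if_cong[where m = "int p"])
  have "[Legendre (a * b) (int p) = (a * b) ^ ((p - 1) div 2)] (mod int p)"
    using euler_criterion assms by blast
  also have "(a * b) ^ ((p - 1) div 2) = a ^ ((p - 1) div 2) * b ^ ((p - 1) div 2)"
    by (rule power_mult_distrib)
  also have "[\<dots> = Legendre a (int p) * Legendre b (int p)] (mod int p)"
    by (intro cong_mult cong_sym[OF euler_criterion[OF assms]])
  finally show "[Legendre (a * b) (int p) = Legendre a (int p) * Legendre b (int p)] (mod int p)" .
  show "Legendre (a * b) (int p) \<in> {-1, 0, 1}" by (rule Legendre_range)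
  show "Legendre a (int p) * Legendre b (int p) \<in> {-1, 0, 1}"
    by (simp add: Legendre_def)
qed (use assms in simp)

lemma Legendre_one: "m > 1 \<Longrightarrow> Legendre 1 m = 1"
  by (auto simp: Legendre_def QuadRes_def cong_def intro!: exI[of _ 1])

lemma Legendre_eq_1_iff:
  "Legendre a m = 1 \<longleftrightarrow> \<not> m dvd a \<and> QuadRes m a"
  by (auto simp: Legendre_def cong_0_iff)

lemma Legendre_minus_one:
  fixes p :: nat
  assumes "prime p" "2 < p"
  shows "Legendre (-1) (int p) = (-1) ^ ((p - 1) div 2)"
proof (rule sign_eq_if_cong[where m = "int p"])
  show "(-1) ^ ((p - 1) div 2) \<in> {-1, 0, 1 :: int}"
    by (simp add: minus_one_power_iff)
  show "[Legendre (-1) (int p) = (-1) ^ ((p - 1) div 2)] (mod int p)"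
    using assms by (rule euler_criterion)
  show "Legendre (-1) (int p) \<in> {-1, 0, 1}" by (rule Legendre_range)
qed (use assms in simp)

lemma Legendre_minus:
  fixes p :: nat
  assumes "prime p" "2 < p"
  shows "Legendre (- a) (int p) = (-1) ^ ((p - 1) div 2) * Legendre a (int p)"
  using Legendre_mult[OF assms, of "-1" a] unfolding Legendre_minus_one[OF assms] by simp

text \<open>Gauss's lemma for the multiplier 2. With \<open>h = (p - 1) / 2\<close>, the doubles of
  \<open>1, ..., h\<close> are already reduced modulo \<open>p\<close>, so the exponent counts the
  \<open>x \<le> h\<close> with \<open>2 x > h\<close>; there are \<open>h - h div 2\<close> of
  them.\<close>

lemma Legendre_two:
  fixes p :: nat
  assumes "prime p" "2 < p"
  shows "Legendre 2 (int p) = (if p mod 8 = 1 \<or> p mod 8 = 7 then 1 else -1)"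
proof -
  have "odd p" using assms prime_odd_nat by blast
  interpret GAUSS p 2
  proof
    show "[2 \<noteq> 0] (mod int p)"
      using assms by (auto simp: cong_0_iff dest: zdvd_imp_le)
  qed (use assms in auto)
  define h where "h = (int p - 1) div 2"
  have p: "int p = 2 * h + 1" using \<open>odd p\<close> unfolding h_def by presburger
  have h: "h > 0" using p assms by linarith
  have "E = (\<lambda>x. x * 2) ` {h div 2 <.. h}"
  proof -
    have "C = B"
    proof -
      have "x mod int p = x" if "x \<in> B" for x
      proof -
        have "0 \<le> x" "x < int p"
          using that p unfolding B_def A_def h_def[symmetric] by auto
        then show ?thesis by (rule mod_pos_pos_trivial)
      qed
      then show ?thesis unfolding C_def by simp
    qed
    have "h div 2 < x \<longleftrightarrow> h < x * 2" for x by linarith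
    moreover have "x > h div 2 \<Longrightarrow> x > 0" for x using h by linarith
    ultimately have "{h div 2 <.. h} = {x \<in> A. h < x * 2}"
      unfolding A_def h_def[symmetric] by (simp add: set_eq_iff) blast
    then show ?thesis
      unfolding E_def \<open>C = B\<close> B_def h_def[symmetric] by blast
  qed
  then have "card E = nat (h - h div 2)"
    by (simp add: card_image inj_on_def)
  moreover have "even (nat (h - h div 2)) \<longleftrightarrow> p mod 8 = 1 \<or> p mod 8 = 7"
  proof -
    define r where "r = h - h div 2"
    have "even (nat r) = even r" using h unfolding r_def by (auto simp: even_nat_iff)
    moreover have "even r \<longleftrightarrow> int p mod 8 = 1 \<or> int p mod 8 = 7"
    proof -
      \<comment> \<open>The residue of \<open>h\<close> modulo 4 determines both the parity of
        \<open>r\<close> and the residue of \<open>p\<close> modulo 8, which leaves four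
        cases.\<close>
      define k where "k = h div 4"
      define c where "c = h mod 4"
      have hkc: "h = 4 * k + c" and c: "c \<in> {0, 1, 2, 3}"
        unfolding k_def c_def by auto
      have "h div 2 = 2 * k + c div 2"
        unfolding hkc by simp
      then have r: "r = 2 * k + (c - c div 2)" and p: "int p = 8 * k + (2 * c + 1)"
        unfolding p r_def hkc by simp_all
      show ?thesis
        unfolding r p using c by auto
    qed
    moreover have "int p mod 8 = int (p mod 8)" by (simp add: zmod_int)
    ultimately show ?thesis unfolding r_def by simp
  qed
  ultimately show ?thesis
    unfolding gauss_lemma minus_one_power_iff by (simp only:)
qed

lemma Legendre_prod_list:
  fixes q :: nat
  assumes "prime q" "2 < q"
  shows "Legendre (int (prod_list ps)) (int q) = (\<Prod>p\<leftarrow>ps. Legendre (int p) (int q))"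
  using assms by (induction ps) (simp_all add: Legendre_one Legendre_mult)

section \<open>Signs and residues for products of primes\<close>

lemma minus_one_power_mult:
  fixes m n :: nat
  assumes "odd m" "odd n"
  shows "(-1::int) ^ ((m * n - 1) div 2) = (-1) ^ ((m - 1) div 2) * (-1) ^ ((n - 1) div 2)"
proof -
  obtain i j where "m = 2 * i + 1" "n = 2 * j + 1" using assms by (auto elim!: oddE)
  \<comment> \<open>The exponent exceeds the sum \<open>i + j\<close> of the two others by the even
    number \<open>2 * (i * j)\<close>. Hence the sign is multiplicative on odd numbers, being the
    nontrivial character modulo 4.\<close>
  moreover from this have "(m * n - 1) div 2 = 2 * (i * j) + i + j"
    by (simp add: algebra_simps)
  ultimately show ?thesis by (simp add: power_add power_mult)
qed

lemma odd_prod_list: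
  "(\<And>p. p \<in> set ps \<Longrightarrow> odd p) \<Longrightarrow> odd (prod_list ps :: nat)"
  by (induction ps) auto

lemma minus_one_power_prod_list:
  fixes ps :: "nat list"
  assumes "\<And>p. p \<in> set ps \<Longrightarrow> odd p"
  shows "(-1::int) ^ ((prod_list ps - 1) div 2) = (\<Prod>p\<leftarrow>ps. (-1) ^ ((p - 1) div 2))"
  using assms
proof (induction ps)
  case (Cons p ps)
  have "odd (prod_list ps)" "odd p" using Cons.prems odd_prod_list[of ps] by simp_all
  then have "(-1::int) ^ ((p * prod_list ps - 1) div 2) =
    (-1) ^ ((p - 1) div 2) * (-1) ^ ((prod_list ps - 1) div 2)"
    by (intro minus_one_power_mult)
  moreover have "(-1::int) ^ ((prod_list ps - 1) div 2) = (\<Prod>p\<leftarrow>ps. (-1) ^ ((p - 1) div 2))"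
    using Cons.prems by (intro Cons.IH) simp
  ultimately show ?case by (simp only: prod_list.Cons list.map)
qed simp

lemma QuadRes_mult_coprime:
  fixes m n :: int
  assumes "QuadRes m a" "QuadRes n a" "coprime m n"
  shows "QuadRes (m * n) a"
proof -
  obtain s t where st: "[s\<^sup>2 = a] (mod m)" "[t\<^sup>2 = a] (mod n)"
    using assms by (auto simp: QuadRes_def)
  obtain x where "[x = s] (mod m)" "[x = t] (mod n)"
    using binary_chinese_remainder_int[OF assms(3)] by blast
  then have "[x\<^sup>2 = a] (mod m)" "[x\<^sup>2 = a] (mod n)"
    using st cong_pow cong_trans by blast+
  then have "[x\<^sup>2 = a] (mod m * n)"
    using assms(3) coprime_cong_mult by blast
  then show ?thesis by (auto simp: QuadRes_def)
qed

text \<open>Square-freeness excludes repeated primes, so the moduli are coprime and the square roots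
  can be glued by the Chinese remainder theorem.\<close>

lemma QuadRes_prod_list:
  fixes ps :: "nat list"
  assumes "\<And>p. p \<in> set ps \<Longrightarrow> prime p \<and> QuadRes (int p) a" "squarefree (prod_list ps)"
  shows "QuadRes (int (prod_list ps)) a"
  using assms
proof (induction ps)
  case Nil
  then show ?case by (simp add: QuadRes_def)
next
  case (Cons p ps)
  have "prime p" using Cons.prems by simp
  have "\<not> p dvd prod_list ps"
  proof
    assume "p dvd prod_list ps"
    then have "p\<^sup>2 dvd prod_list (p # ps)" by (simp add: power2_eq_square)
    then have "is_unit p" using Cons.prems(2) unfolding squarefree_def by blast
    then show False using \<open>prime p\<close> by simp
  qed
  then have "coprime (int p) (int (prod_list ps))"
    using \<open>prime p\<close> by (simp add: prime_imp_coprime)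
  moreover have "squarefree (prod_list ps)"
    using Cons.prems(2) squarefree_multD by simp
  ultimately show ?case
    using Cons QuadRes_mult_coprime by simp
qed

section \<open>Norms with a square-free value\<close>

text \<open>The prime \<open>q\<close> divides \<open>q * n\<close> exactly once. This supplies the
  non-square hypothesis of \<open>is_rat_norm_if_QuadRes\<close>.\<close>

lemma prime_mult_not_square:
  fixes q :: int
  assumes "prime q" "\<not> q dvd n"
  shows "q * n \<noteq> c\<^sup>2"
proof
  assume *: "q * n = c\<^sup>2"
  then have "q dvd c\<^sup>2" by (metis dvd_triv_left)
  then have "q dvd c" using assms(1) prime_dvd_power by blast
  then obtain d where "c = q * d" by blast
  then have "q * n = q * (q * d\<^sup>2)" using * by (simp add: power2_eq_square mult_ac)
  then have "n = q * d\<^sup>2" using assms(1) by (metis mult_cancel_left not_prime_0)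
  then show False using assms(2) by simp
qed

lemma squarefree_not_prime_power2_dvd:
  fixes n p :: nat
  assumes "squarefree n" "prime p"
  shows "\<not> (int p)\<^sup>2 dvd int n"
proof -
  have "\<not> p\<^sup>2 dvd n" using assms not_prime_unit unfolding squarefree_def by blast
  then show ?thesis by (metis int_dvd_int_iff of_nat_power)
qed

lemma squarefree_prime_split:
  fixes n p :: nat
  assumes "squarefree n" "prime p"
  obtains b m where "b \<in> {0, 1}" "n = p ^ b * m" "\<not> p dvd m" "squarefree m"
proof (cases "p dvd n")
  case True
  then obtain m where m: "n = p * m" by blast
  then have "\<not> p dvd m"
    using squarefree_not_prime_power2_dvd[OF assms] by (auto simp: power2_eq_square)
  moreover have "squarefree m" using assms(1) m squarefree_multD by blast
  ultimately show ?thesis using that[of 1 m] m by simp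
next
  case False
  then show ?thesis using that[of 0 n] assms by simp
qed

lemma prime_factor_list:
  fixes n :: nat
  assumes "n > 0"
  obtains ps where "n = prod_list ps" "\<And>p. p \<in> set ps \<Longrightarrow> prime p"
proof -
  obtain ps where ps: "mset ps = prime_factorization n" using ex_mset by blast
  then have "prod_list ps = n"
    using prod_mset_prod_list[of ps] prod_mset_prime_factorization_nat[OF assms] by simp
  moreover have "prime p" if "p \<in> set ps" for p
    using that ps by (metis in_prime_factors_iff set_mset_mset)
  ultimately show ?thesis using that by metis
qed

lemma prime_mem_dvd_prod_list: "p \<in> set ps \<Longrightarrow> p dvd (prod_list ps :: nat)"
  by (induction ps) auto

lemma Legendre_neg_eq_1_if_is_rat_norm:
  fixes n p k :: nat
  assumes "is_rat_norm (int k) (int n)" "squarefree n" "prime p" "p dvd n" "\<not> p dvd k"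
  shows "Legendre (- int k) (int p) = 1"
proof -
  have "QuadRes (int p) (- int k)"
    using assms squarefree_not_prime_power2_dvd by (intro QuadRes_neg_if_is_rat_norm[of _ "int n"]) auto
  then show ?thesis using assms by (simp add: Legendre_eq_1_iff)
qed

lemma is_rat_norm_odd_prime:
  fixes p k :: nat
  assumes "prime p" "odd p" "k \<in> {1, 2}" "Legendre (- int k) (int p) = 1"
  shows "is_rat_norm (int k) (int p)"
proof (rule is_rat_norm_if_QuadRes)
  show "int k > 0" "int p > 0" using assms prime_gt_0_nat by auto
  show "coprime (int k) (int p)" using assms(2,3) by auto
  show "int k * int p \<noteq> c\<^sup>2" for c
  proof (cases "k = 1")
    case True
    then show ?thesis using prime_mult_not_square[of "int p" 1 c] assms(1) prime_gt_1_nat[of p] by auto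
  next
    case False
    then show ?thesis using prime_mult_not_square[of 2 "int p" c] assms by auto
  qed
  show "QuadRes (int p) (- int k)" using assms by (simp add: Legendre_eq_1_iff)
  \<comment> \<open>The condition modulo \<open>k\<close> is free: for \<open>k = 1\<close> it is
    empty, and for \<open>k = 2\<close> the odd \<open>p\<close> is congruent to 1.\<close>
  have "[1\<^sup>2 = int p] (mod int k)"
    using assms by (auto simp: cong_def mod_2_eq_odd)
  then show "QuadRes (int k) (int p)" unfolding QuadRes_def by blast
qed

lemma is_rat_norm_1_2: "is_rat_norm 1 2"
  unfolding is_rat_norm_def by (intro exI[of _ 1]) simp

lemma odd_prime_gt_2: "prime p \<Longrightarrow> odd p \<Longrightarrow> 2 < (p :: nat)"
  by (metis even_numeral le_neq_implies_less prime_ge_2_nat)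

text \<open>Necessity is the condition at each odd prime divisor. For sufficiency, 2 and every
  admissible odd prime are norms on their own for these two values of \<open>k\<close>, so
  multiplicativity is enough.\<close>

lemma is_rat_norm_1_or_2_iff:
  fixes n k :: nat
  assumes "squarefree n" "k \<in> {1, 2}"
  shows "is_rat_norm (int k) (int n) \<longleftrightarrow>
    (\<exists>b \<in> {0, 1 :: nat}. \<exists>ps. n = 2 ^ b * prod_list ps \<and>
      (\<forall>p \<in> set ps. prime p \<and> odd p \<and> Legendre (- int k) (int p) = 1))" (is "_ \<longleftrightarrow> ?rhs")
proof
  assume norm: "is_rat_norm (int k) (int n)"
  obtain b m where b: "b \<in> {0, 1}" "n = 2 ^ b * m" and m: "odd m" "squarefree m"
    using squarefree_prime_split[OF assms(1) two_is_prime_nat] by metis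
  obtain ps where ps: "m = prod_list ps" "\<And>p. p \<in> set ps \<Longrightarrow> prime p"
    using prime_factor_list[of m] m by (metis odd_pos)
  have "prime p \<and> odd p \<and> Legendre (- int k) (int p) = 1" if "p \<in> set ps" for p
  proof -
    have "p dvd m" using prime_mem_dvd_prod_list that ps by blast
    then have "odd p" using m by (metis dvd_trans)
    then have "\<not> p dvd k"
      using assms(2) odd_prime_gt_2[OF ps(2)[OF that]] by (auto dest!: dvd_imp_le)
    then show ?thesis
      using Legendre_neg_eq_1_if_is_rat_norm[OF norm assms(1)] ps(2)[OF that] \<open>p dvd m\<close> \<open>odd p\<close> b
      by simp
  qed
  then show ?rhs using b ps by blast
next
  assume ?rhs
  then obtain b ps where *: "n = 2 ^ b * prod_list ps"
    "\<And>p. p \<in> set ps \<Longrightarrow> prime p \<and> odd p \<and> Legendre (- int k) (int p) = 1" "b \<in> {0, 1}" by blast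
  have "is_rat_norm (int k) (2 ^ b)"
    using assms(2) *(3) is_rat_norm_1_2 is_rat_norm_self[of 2] by auto
  moreover have "is_rat_norm (int k) (prod_list (map int ps))"
    using * assms(2) by (intro is_rat_norm_prod_list) (auto intro!: is_rat_norm_odd_prime)
  moreover have "prod_list (map int ps) = int (prod_list ps)" by (induction ps) auto
  ultimately show "is_rat_norm (int k) (int n)"
    using * is_rat_norm_mult by simp
qed

lemma Legendre_minus_one_eq_1_iff:
  fixes p :: nat
  assumes "prime p" "odd p"
  shows "Legendre (- 1) (int p) = 1 \<longleftrightarrow> p mod 4 = 1"
proof -
  have "even ((p - 1) div 2) \<longleftrightarrow> p mod 4 = 1"
    using assms(2) by presburger
  then show ?thesis
    using Legendre_minus_one[of p] odd_prime_gt_2[OF assms] assms by (simp add: minus_one_power_iff)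
qed

lemma Legendre_minus_two_eq_1_iff:
  fixes p :: nat
  assumes "prime p" "odd p"
  shows "Legendre (- 2) (int p) = 1 \<longleftrightarrow> p mod 8 = 1 \<or> p mod 8 = 3"
proof -
  define r where "r = p mod 8"
  define t where "t = p div 8"
  have p: "p = 8 * t + r" and "r < 8" unfolding r_def t_def by simp_all
  moreover have "odd r" using p assms(2) by simp
  ultimately have "r = 1 \<or> r = 3 \<or> r = 5 \<or> r = 7" by presburger
  then show ?thesis
    using Legendre_minus[of p 2] Legendre_two[of p] odd_prime_gt_2[OF assms] assms(1)
    unfolding r_def[symmetric] by (elim disjE) (simp_all add: minus_one_power_iff p)
qed

text \<open>As \<open>q\<close> is itself a norm, a factor \<open>q\<close> of \<open>n\<close> can
  be cancelled. Unlike for \<open>k = 1\<close> and \<open>k = 2\<close>, the primes in the cofactor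
  need not be norms one by one, so the sufficient criterion is applied to the whole cofactor
  \<open>2 ^ b * prod_list ps\<close>. The condition at 2 is automatic because \<open>q\<close> is
  odd.\<close>

lemma is_rat_norm_prime_iff:
  fixes q n :: nat
  assumes q: "prime q" "odd q" and n: "squarefree n"
  shows "is_rat_norm (int q) (int n) \<longleftrightarrow>
    (\<exists>b \<in> {0, 1 :: nat}. \<exists>b' \<in> {0, 1 :: nat}. \<exists>ps. n = 2 ^ b * q ^ b' * prod_list ps \<and>
      (\<forall>p \<in> set ps. prime p \<and> odd p \<and> Legendre (- int q) (int p) = 1) \<and>
      Legendre (int (2 ^ b * prod_list ps)) (int q) = 1)" (is "_ \<longleftrightarrow> ?rhs")
proof
  assume norm: "is_rat_norm (int q) (int n)"
  obtain b' r where b': "b' \<in> {0, 1}" "n = q ^ b' * r" and r: "\<not> q dvd r" "squarefree r"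
    using squarefree_prime_split[OF n q(1)] by metis
  obtain b m where b: "b \<in> {0, 1}" "r = 2 ^ b * m" and m: "odd m" "squarefree m"
    using squarefree_prime_split[OF r(2) two_is_prime_nat] by metis
  obtain ps where ps: "m = prod_list ps" "\<And>p. p \<in> set ps \<Longrightarrow> prime p"
    using prime_factor_list[of m] m by (metis odd_pos)
  have "prime p \<and> odd p \<and> Legendre (- int q) (int p) = 1" if "p \<in> set ps" for p
  proof -
    have "p dvd m" using prime_mem_dvd_prod_list that ps by blast
    then have "odd p" using m(1) by (metis dvd_trans)
    have "p dvd r" using \<open>p dvd m\<close> b by simp
    then have "p \<noteq> q" using r by blast
    then have "\<not> p dvd q" using q ps(2)[OF that] primes_dvd_imp_eq by blast
    then show ?thesis
      using Legendre_neg_eq_1_if_is_rat_norm[OF norm n] ps(2)[OF that] \<open>p dvd r\<close> \<open>odd p\<close> b'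
      by simp
  qed
  moreover have "Legendre (int r) (int q) = 1"
  proof -
    have "is_rat_norm (int q) (int q ^ b')" using b' by auto
    then have "is_rat_norm (int q) (int r)"
      using norm b' q is_rat_norm_mult_cancel[of "int q" "int q ^ b'" "int r"]
      by (simp add: mult.commute prime_gt_0_nat)
    then show ?thesis
      using q r QuadRes_if_is_rat_norm_prime[of "int q" "int r"] by (simp add: Legendre_eq_1_iff)
  qed
  moreover have "n = 2 ^ b * q ^ b' * prod_list ps"
    unfolding b' b ps(1) by (simp only: mult_ac)
  ultimately show ?rhs using b b' ps(1) by blast
next
  assume ?rhs
  then obtain b b' ps where b: "b \<in> {0, 1}" "b' \<in> {0, 1}" "n = 2 ^ b * q ^ b' * prod_list ps"
    and ps': "\<forall>p \<in> set ps. prime p \<and> odd p \<and> Legendre (- int q) (int p) = 1"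
    and leg: "Legendre (int (2 ^ b * prod_list ps)) (int q) = 1"
    by (elim bexE exE conjE)
  note ps = bspec[OF ps']
  define r where "r = 2 ^ b * prod_list ps"
  have nr: "n = r * q ^ b'" unfolding b(3) r_def by (simp only: mult_ac)
  have "\<not> int q dvd int r" "QuadRes (int q) (int r)"
    using leg[folded r_def] unfolding Legendre_eq_1_iff by blast+
  have "is_rat_norm (int q) (int r)"
  proof (rule is_rat_norm_if_QuadRes)
    show "int q > 0" using q prime_gt_0_nat by simp
    show "int r > 0" using \<open>\<not> int q dvd int r\<close> by (cases r) auto
    show "coprime (int q) (int r)"
      using q \<open>\<not> int q dvd int r\<close> by (intro prime_imp_coprime) auto
    show "int q * int r \<noteq> c\<^sup>2" for c
      using q \<open>\<not> int q dvd int r\<close> by (intro prime_mult_not_square) auto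
    \<comment> \<open>Putting the possible factor 2 into the list of primes allows
      \<open>QuadRes_prod_list\<close> to treat it like the others.\<close>
    have r_list: "r = prod_list (replicate b 2 @ ps)" by (simp add: r_def)
    have "[1\<^sup>2 = - int q] (mod 2)" using q by (simp add: cong_iff_dvd_diff)
    then have "QuadRes 2 (- int q)" unfolding QuadRes_def by blast
    have *: "p = 2 \<or> p \<in> set ps" if "p \<in> set (replicate b 2 @ ps)" for p
      using that by (auto split: if_splits)
    have "prime p \<and> QuadRes (int p) (- int q)" if mem: "p \<in> set (replicate b 2 @ ps)" for p
    proof -
      consider "p = 2" | "p \<in> set ps" using *[OF mem] by blast
      then show ?thesis
      proof cases
        case 1
        then show ?thesis using \<open>QuadRes 2 (- int q)\<close> by simp
      next
        case 2
        then show ?thesis using ps[OF 2] by (simp only: Legendre_eq_1_iff)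
      qed
    qed
    moreover have "squarefree r" using n nr squarefree_multD(1) by blast
    ultimately show "QuadRes (int r) (- int q)"
      unfolding r_list by (rule QuadRes_prod_list)
  qed fact
  moreover have "is_rat_norm (int q) (int q ^ b')" using b by auto
  ultimately show "is_rat_norm (int q) (int n)"
    unfolding nr using is_rat_norm_mult by simp
qed

section \<open>The conditions restated by quadratic reciprocity\<close>

lemma Legendre_in_pm1: "\<not> m dvd a \<Longrightarrow> Legendre a m = 1 \<or> Legendre a m = -1"
  by (simp add: Legendre_def cong_0_iff)

lemma Legendre_minus_prime_iff:
  fixes p q :: nat
  assumes p: "prime p" "odd p" and q: "prime q" "odd q"
  shows "Legendre (- int q) (int p) = 1 \<longleftrightarrow>
    Legendre (int p) (int q) = (if q mod 4 = 1 then (-1) ^ ((p - 1) div 2) else 1)"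
proof (cases "p = q")
  \<comment> \<open>For \<open>p = q\<close> both symbols vanish while the right-hand side is a
    sign, so both equations fail.\<close>
  case True
  have "Legendre (- int q) (int q) = 0" "Legendre (int q) (int q) = 0"
    by (simp_all add: Legendre_def cong_0_iff)
  then show ?thesis using True by (simp add: minus_one_power_iff)
next
  case False
  have gt: "2 < p" "2 < q" using p q odd_prime_gt_2 by blast+
  define \<epsilon> :: int where "\<epsilon> = (-1) ^ ((p - 1) div 2)"
  have \<epsilon>: "\<epsilon> = 1 \<or> \<epsilon> = -1" unfolding \<epsilon>_def by (simp add: minus_one_power_iff)
  have "\<not> p dvd q" "\<not> q dvd p" using False p q primes_dvd_imp_eq by blast+
  define u where "u = Legendre (int q) (int p)"
  define v where "v = Legendre (int p) (int q)"
  have u: "u = 1 \<or> u = -1" and v: "v = 1 \<or> v = -1"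
    unfolding u_def v_def using \<open>\<not> p dvd q\<close> \<open>\<not> q dvd p\<close> by (simp_all add: Legendre_in_pm1)
  \<comment> \<open>The reciprocity sign is trivial for \<open>q\<close> congruent to 1 modulo 4 and
    equals \<open>\<epsilon>\<close> otherwise. Together with the factor \<open>\<epsilon>\<close>
    from \<open>-1\<close>, this turns the symbol modulo \<open>p\<close> into one modulo
    \<open>q\<close>.\<close>
  have reciprocity: "v * u = (if q mod 4 = 1 then 1 else \<epsilon>)"
  proof -
    have "even ((q - 1) div 2) \<longleftrightarrow> q mod 4 = 1" using q(2) by presburger
    then have "(-1::int) ^ ((p - 1) div 2 * ((q - 1) div 2)) = (if q mod 4 = 1 then 1 else \<epsilon>)"
      unfolding \<epsilon>_def by (auto simp: minus_one_power_iff)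
    then show ?thesis
      unfolding u_def v_def Quadratic_Reciprocity[OF p(1) gt(1) q(1) gt(2) False] .
  qed
  have "Legendre (- int q) (int p) = \<epsilon> * u"
    unfolding \<epsilon>_def u_def using Legendre_minus p(1) gt(1) by blast
  then show ?thesis
    unfolding \<epsilon>_def[symmetric] v_def[symmetric]
    using u v \<epsilon> reciprocity by (elim disjE) (simp_all split: if_splits)
qed

text \<open>Given the conditions at the \<open>p\<close>, the symbol of their product modulo
  \<open>q\<close> is a product of signs and collapses to the sign of \<open>prod_list ps\<close>.
  The power of \<open>Legendre 2 (int q)\<close> is left open here; its value separates
  \<open>q\<close> congruent to 1 and to 5 modulo 8.\<close>

lemma is_rat_norm_prime_1_mod_4_iff:
  fixes q n :: nat
  assumes q: "prime q" "q mod 4 = 1" and n: "squarefree n"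
  shows "is_rat_norm (int q) (int n) \<longleftrightarrow>
    (\<exists>b \<in> {0, 1 :: nat}. \<exists>b' \<in> {0, 1 :: nat}. \<exists>ps. n = 2 ^ b * q ^ b' * prod_list ps \<and>
      (\<forall>p \<in> set ps. prime p \<and> odd p \<and> Legendre (int p) (int q) = (-1) ^ ((p - 1) div 2)) \<and>
      Legendre 2 (int q) ^ b * (-1) ^ ((prod_list ps - 1) div 2) = 1)"
proof -
  have "odd q" using q(2) by presburger
  then have q2: "2 < q" using odd_prime_gt_2 q(1) by blast
  have *: "Legendre (int (2 ^ b * prod_list ps)) (int q) =
      Legendre 2 (int q) ^ b * (-1) ^ ((prod_list ps - 1) div 2)"
    if "b \<in> {0, 1}" "\<forall>p \<in> set ps. prime p \<and> odd p \<and> Legendre (int p) (int q) = (-1) ^ ((p - 1) div 2)"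
    for b :: nat and ps :: "nat list"
  proof -
    have "Legendre (int (prod_list ps)) (int q) = (\<Prod>p\<leftarrow>ps. Legendre (int p) (int q))"
      using Legendre_prod_list q(1) q2 by blast
    also have "\<dots> = (\<Prod>p\<leftarrow>ps. (-1) ^ ((p - 1) div 2))"
      using that(2) by (intro arg_cong[of _ _ prod_list] map_cong) auto
    also have "\<dots> = (-1) ^ ((prod_list ps - 1) div 2)"
      using that(2) by (intro minus_one_power_prod_list[symmetric]) auto
    finally show ?thesis
      using that(1) Legendre_mult[OF q(1) q2, of 2 "int (prod_list ps)"] by auto
  qed
  have leg: "prime p \<and> odd p \<and> Legendre (- int q) (int p) = 1 \<longleftrightarrow>
      prime p \<and> odd p \<and> Legendre (int p) (int q) = (-1) ^ ((p - 1) div 2)" for p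
    using Legendre_minus_prime_iff[OF _ _ q(1) \<open>odd q\<close>] q(2) by auto
  show ?thesis
    unfolding is_rat_norm_prime_iff[OF q(1) \<open>odd q\<close> n] leg
  proof (rule bex_cong[OF refl], rule bex_cong[OF refl], rule ex_cong1, rule conj_cong[OF refl],
      rule conj_cong[OF refl])
  qed (simp only: *)
qed

section \<open>Primes congruent to 3 modulo 8: the obstruction at 2\<close>

lemma odd_power2_mod_8:
  fixes x :: int
  assumes "odd x"
  shows "x\<^sup>2 mod 8 = 1"
proof -
  obtain k where "x = 2 * k + 1" using assms by (elim oddE)
  then have "x\<^sup>2 = 4 * (k * (k + 1)) + 1" by (simp add: power2_eq_square algebra_simps)
  moreover have "even (k * (k + 1))" by simp
  then obtain j where "k * (k + 1) = 2 * j" by (elim evenE)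
  ultimately show ?thesis by simp
qed

text \<open>In a solution primitive at 2, even \<open>x\<close> and \<open>y\<close> would force
  \<open>z\<close> even. If both are odd, then \<open>x^2 + q y^2\<close> is 4 modulo 8 and contains
  the prime 2 exactly twice, but \<open>2 n z^2\<close> contains it an odd number of times.\<close>

lemma not_is_rat_norm_twice_odd:
  fixes q n :: int
  assumes "q mod 8 = 3" "odd n"
  shows "\<not> is_rat_norm q (2 * n)"
proof
  assume "is_rat_norm q (2 * n)"
  then obtain x y z where xyz: "x\<^sup>2 + q * y\<^sup>2 = 2 * n * z\<^sup>2" "\<not> (even x \<and> even y \<and> even z)"
    by (rule is_rat_norm_primitive[where p = 2]) auto
  have "odd q" using assms(1) by presburger
  have "even (x\<^sup>2 + q * y\<^sup>2)" using xyz by simp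
  then have parity: "even x \<longleftrightarrow> even y" using \<open>odd q\<close> by simp
  show False
  proof (cases "even x")
    case True
    then obtain u v where "x = 2 * u" "y = 2 * v" using parity by (elim evenE) auto
    then have "n * z\<^sup>2 = 2 * (u\<^sup>2 + q * v\<^sup>2)" using xyz(1) by (simp add: power2_eq_square)
    then have "even (n * z\<^sup>2)" by simp
    then show False using xyz True parity assms(2) by simp
  next
    case False
    obtain i where i: "x\<^sup>2 = 8 * i + 1"
      using odd_power2_mod_8[OF False] by (metis mult_div_mod_eq)
    obtain j where j: "y\<^sup>2 = 8 * j + 1"
      using odd_power2_mod_8[of y] False parity by (metis mult_div_mod_eq)
    obtain l where l: "q = 8 * l + 3" using assms(1) by (metis mult_div_mod_eq)
    have eq: "n * z\<^sup>2 = 4 * (i + 8 * l * j + l + 3 * j) + 2"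
      using xyz(1) unfolding i j l by (simp add: algebra_simps)
    then have "even (n * z\<^sup>2)" by simp
    then have "even z" using assms(2) by simp
    then obtain w where "z = 2 * w" by (elim evenE)
    then have "4 * (n * w\<^sup>2) = 4 * (i + 8 * l * j + l + 3 * j) + 2"
      using eq by (simp add: power2_eq_square mult_ac)
    then show False by presburger
  qed
qed

text \<open>The obstruction at 2 forces \<open>n = 2 * m\<close> with \<open>m\<close> odd, and then
  \<open>2 * n\<close> is \<open>m\<close> times the square 4. Since \<open>q\<close> is 3 modulo 4,
  the conditions at the \<open>p\<close> read \<open>Legendre (int p) (int q) = 1\<close>, and their
  product gives the condition at \<open>q\<close>.\<close>

lemma is_rat_norm_twice_prime_3_mod_8_iff:
  fixes q n :: nat
  assumes q: "prime q" "q mod 8 = 3" and n: "squarefree n"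
  shows "is_rat_norm (int q) (2 * int n) \<longleftrightarrow>
    (\<exists>b' \<in> {0, 1 :: nat}. \<exists>ps. n = 2 * q ^ b' * prod_list ps \<and>
      (\<forall>p \<in> set ps. prime p \<and> odd p \<and> Legendre (int p) (int q) = 1))" (is "_ \<longleftrightarrow> ?rhs")
proof -
  have "odd q" using q(2) by presburger
  then have q2: "2 < q" using odd_prime_gt_2 q(1) by blast
  have "q mod 4 \<noteq> 1" using q(2) by presburger
  then have leg: "Legendre (- int q) (int p) = 1 \<longleftrightarrow> Legendre (int p) (int q) = 1"
    if "prime p" "odd p" for p
    using Legendre_minus_prime_iff[OF that q(1) \<open>odd q\<close>] by simp
  have cancel: "is_rat_norm (int q) (2 * int (2 * m)) \<longleftrightarrow> is_rat_norm (int q) (int m)" for m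
    using is_rat_norm_mult_square_iff[of 2 "int q" "int m"] by (simp add: mult.commute)
  show ?thesis
  proof
    assume norm: "is_rat_norm (int q) (2 * int n)"
    have "int q mod 8 = 3" using q(2) by (metis of_nat_mod of_nat_numeral)
    then have "even n" using norm not_is_rat_norm_twice_odd[of "int q" "int n"] by (metis even_of_nat)
    then obtain m where m: "n = 2 * m" by (elim evenE)
    then have "odd m" using squarefree_not_prime_power2_dvd[OF n two_is_prime_nat]
      by (auto simp: power2_eq_square)
    have "is_rat_norm (int q) (int m)" using norm cancel m by blast
    moreover have "squarefree m" using n m squarefree_multD by blast
    ultimately obtain b b' ps where *: "b' \<in> {0, 1::nat}" "m = 2 ^ b * q ^ b' * prod_list ps"
      "\<forall>p \<in> set ps. prime p \<and> odd p \<and> Legendre (- int q) (int p) = 1" "b \<in> {0, 1::nat}"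
      using is_rat_norm_prime_iff[OF q(1) \<open>odd q\<close>, of m] by blast
    then have "b = 0" using \<open>odd m\<close> by auto
    then have "n = 2 * q ^ b' * prod_list ps" using * m by simp
    then show ?rhs using * leg by blast
  next
    assume ?rhs
    then obtain b' ps where *: "b' \<in> {0, 1 :: nat}" "n = 2 * q ^ b' * prod_list ps"
      "\<forall>p \<in> set ps. prime p \<and> odd p \<and> Legendre (int p) (int q) = 1" by blast
    define m where "m = q ^ b' * prod_list ps"
    have m: "n = 2 * m" using * m_def by simp
    have "squarefree m" using n m squarefree_multD by blast
    have "Legendre (int (prod_list ps)) (int q) = 1"
    proof -
      have "Legendre (int (prod_list ps)) (int q) = (\<Prod>p\<leftarrow>ps. Legendre (int p) (int q))"
        using Legendre_prod_list q(1) q2 by blast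
      also have "\<dots> = (\<Prod>p\<leftarrow>ps. 1)"
        using * by (intro arg_cong[of _ _ prod_list] map_cong) auto
      finally show ?thesis by (simp add: map_replicate_const)
    qed
    then have "Legendre (int (2 ^ 0 * prod_list ps)) (int q) = 1" by simp
    moreover have "m = 2 ^ 0 * q ^ b' * prod_list ps" by (simp add: m_def)
    moreover have "\<forall>p \<in> set ps. prime p \<and> odd p \<and> Legendre (- int q) (int p) = 1"
      using * leg by blast
    ultimately have "is_rat_norm (int q) (int m)"
      using *(1) is_rat_norm_prime_iff[OF q(1) \<open>odd q\<close> \<open>squarefree m\<close>] by blast
    then show "is_rat_norm (int q) (2 * int n)" using cancel m by blast
  qed
qed

section \<open>Vectors orthogonal to an integer vector\<close>

definition idot :: "int ^ 3 \<Rightarrow> int ^ 3 \<Rightarrow> int" where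
  "idot v w = (\<Sum>i\<in>UNIV. v $ i * w $ i)"

definition icross :: "int ^ 3 \<Rightarrow> int ^ 3 \<Rightarrow> int ^ 3" where
  "icross v w = vector [v$2 * w$3 - v$3 * w$2, v$3 * w$1 - v$1 * w$3, v$1 * w$2 - v$2 * w$1]"

lemma idot_expand: "idot v w = v$1 * w$1 + v$2 * w$2 + v$3 * w$3"
  by (simp add: idot_def sum_3)

lemma idot_commute: "idot v w = idot w v"
  by (simp add: idot_def mult.commute)

lemma idot_add_left: "idot (u + v) w = idot u w + idot v w"
  and idot_diff_left: "idot (u - v) w = idot u w - idot v w"
  and idot_scale_left: "idot (c *s v) w = c * idot v w"
  by (simp_all add: idot_def sum.distrib sum_subtractf sum_distrib_left algebra_simps)

lemma idot_add_right: "idot w (u + v) = idot w u + idot w v"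
  and idot_diff_right: "idot w (u - v) = idot w u - idot w v"
  and idot_scale_right: "idot w (c *s v) = c * idot w v"
  by (simp_all add: idot_commute[of w] idot_add_left idot_diff_left idot_scale_left)

lemmas idot_linear = idot_add_left idot_diff_left idot_scale_left
  idot_add_right idot_diff_right idot_scale_right

lemma idot_self_eq_0_iff: "idot v v = 0 \<longleftrightarrow> v = 0"
  by (simp add: idot_def sum_nonneg_eq_0_iff vec_eq_iff)

lemma idot_icross [simp]: "idot v (icross v w) = 0" "idot w (icross v w) = 0"
  by (simp_all add: idot_expand icross_def algebra_simps)

text \<open>Lagrange's identity.\<close>

lemma idot_icross_icross:
  "idot (icross v w) (icross v w) = idot v v * idot w w - (idot v w)\<^sup>2"
  by (simp add: idot_expand icross_def power2_eq_square algebra_simps)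

lemma gram_det_orthogonal:
  assumes "idot u a = 0" "idot w a = 0"
  shows "idot w w * idot u u * idot a a = idot a a * (idot w u)\<^sup>2 + (idot (icross w u) a)\<^sup>2"
proof -
  \<comment> \<open>For arbitrary vectors this says that the Gram determinant of \<open>w\<close>,
    \<open>u\<close>, \<open>a\<close> is the square of their determinant; orthogonality to
    \<open>a\<close> removes the right-hand side.\<close>
  have "idot w w * idot u u * idot a a - idot a a * (idot w u)\<^sup>2 - (idot (icross w u) a)\<^sup>2 =
      idot u u * (idot w a)\<^sup>2 + idot w w * (idot u a)\<^sup>2 - 2 * idot w u * idot u a * idot w a"
    unfolding idot_expand icross_def vector_3 power2_eq_square by (simp add: algebra_simps)
  then show ?thesis using assms by simp
qed

text \<open>The plane orthogonal to \<open>a\<close> has the orthogonal basis \<open>u\<close>, \<open>a \<times> u\<close>, so its form is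
  \<open>\<parallel>u\<parallel>\<^sup>2\<close> times \<open>x\<^sup>2 + q y\<^sup>2\<close> up to squares.\<close>

lemma orthogonal_represents_iff_is_rat_norm:
  fixes q M n :: int
  assumes a: "idot a a = q * M\<^sup>2" "q \<noteq> 0" "M \<noteq> 0" and u: "idot u a = 0" "u \<noteq> 0"
  shows "(\<exists>w d. d \<noteq> 0 \<and> idot w a = 0 \<and> idot w w = n * d\<^sup>2) \<longleftrightarrow> is_rat_norm q (n * idot u u)"
proof
  assume "\<exists>w d. d \<noteq> 0 \<and> idot w a = 0 \<and> idot w w = n * d\<^sup>2"
  then obtain w d where w: "d \<noteq> 0" "idot w a = 0" "idot w w = n * d\<^sup>2" by blast
  \<comment> \<open>Up to scaling, \<open>X\<close> and \<open>Y\<close> are the coordinates of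
    \<open>w\<close> with respect to \<open>u\<close> and \<open>a \<times> u\<close>.\<close>
  define X where "X = idot w u"
  define Y where "Y = idot (icross w u) a"
  have "n * d\<^sup>2 * idot u u * (q * M\<^sup>2) = q * M\<^sup>2 * X\<^sup>2 + Y\<^sup>2"
    using gram_det_orthogonal[OF u(1) w(2)] unfolding w(3) a(1) X_def Y_def .
  \<comment> \<open>The factor \<open>q\<close> turns \<open>q * M\<^sup>2 * X\<^sup>2\<close> into
    a square and moves the coefficient \<open>q\<close> to the other term.\<close>
  from arg_cong[OF this, of "(*) q"]
  have "(q * M * X)\<^sup>2 + q * Y\<^sup>2 = n * idot u u * (q * M * d)\<^sup>2"
    by (simp add: power2_eq_square algebra_simps)
  then show "is_rat_norm q (n * idot u u)"
    unfolding is_rat_norm_def using a w(1) by (metis mult_eq_0_iff)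
next
  assume "is_rat_norm q (n * idot u u)"
  then obtain x y z where xyz: "z \<noteq> 0" "x\<^sup>2 + q * y\<^sup>2 = n * idot u u * z\<^sup>2"
    by (auto simp: is_rat_norm_def)
  \<comment> \<open>The second basis vector has squared length
    \<open>q * M\<^sup>2 * idot u u\<close>; the factor \<open>M\<close> in the first coefficient
    compensates for this \<open>M\<^sup>2\<close>.\<close>
  define w where "w = (M * x) *s u + y *s icross a u"
  have "idot w a = 0"
    unfolding w_def idot_linear using u by (simp add: idot_commute[of _ a])
  moreover have "idot w w = n * (idot u u * M * z)\<^sup>2"
  proof -
    have "idot w w = (M * x)\<^sup>2 * idot u u + y\<^sup>2 * idot (icross a u) (icross a u)"
      unfolding w_def idot_linear by (simp add: idot_commute[of "icross a u" u] power2_eq_square algebra_simps)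
    also have "\<dots> = idot u u * M\<^sup>2 * (x\<^sup>2 + q * y\<^sup>2)"
      using u(1) unfolding idot_icross_icross a(1)
      by (simp add: idot_commute[of a u] power2_eq_square algebra_simps)
    finally show ?thesis
      unfolding xyz(2) by (simp add: power2_eq_square algebra_simps)
  qed
  moreover have "idot u u * M * z \<noteq> 0" using xyz(1) u(2) a(3) by (simp add: idot_self_eq_0_iff)
  ultimately show "\<exists>w d. d \<noteq> 0 \<and> idot w a = 0 \<and> idot w w = n * d\<^sup>2" by blast
qed

text \<open>The vector \<open>u\<close> is a multiple of the image of \<open>e\<close> under the reflection that maps
  \<open>a\<^sub>0\<close> to \<open>a\<close>.\<close>

lemma reflected_orthogonal:
  assumes "idot a a = idot a\<^sub>0 a\<^sub>0" "idot e a\<^sub>0 = 0"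
  obtains u s where "s \<noteq> 0" "idot u a = 0" "idot u u = idot e e * s\<^sup>2"
proof (cases "a = a\<^sub>0")
  case True
  then show ?thesis using that[of 1 e] assms(2) by simp
next
  case False
  define r where "r = a - a\<^sub>0"
  define u where "u = idot r r *s e - (2 * idot e r) *s r"
  have "idot r r \<noteq> 0" using False by (simp add: idot_self_eq_0_iff r_def)
  moreover have "idot u a = 0"
  proof -
    have "idot e r = idot e a" "idot r r = 2 * idot r a"
      using assms unfolding r_def idot_linear by (simp_all add: idot_commute[of a\<^sub>0 a])
    then show ?thesis unfolding u_def idot_linear by simp
  qed
  moreover have "idot u u = idot e e * (idot r r)\<^sup>2"
    unfolding u_def idot_linear idot_commute[of r e] by (simp add: power2_eq_square algebra_simps)
  ultimately show ?thesis using that by blast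
qed

text \<open>Here \<open>a\<^sub>0\<close> is a model vector that can be chosen freely. Scaling
  \<open>a\<close> by \<open>c\<close> and \<open>a\<^sub>0\<close> by \<open>M\<close> equalises
  the lengths; the reflection then replaces \<open>e\<close> by a vector orthogonal to
  \<open>a\<close> whose squared length differs from that of \<open>e\<close> by a square factor
  only.\<close>

lemma orthogonal_represents_iff:
  fixes q M c n :: int
  assumes a: "idot a a = q * M\<^sup>2" "q \<noteq> 0" "M \<noteq> 0"
    and a\<^sub>0: "idot a\<^sub>0 a\<^sub>0 = q * c\<^sup>2" "c \<noteq> 0" and e: "idot e a\<^sub>0 = 0" "e \<noteq> 0"
  shows "(\<exists>w d. d \<noteq> 0 \<and> idot w a = 0 \<and> idot w w = n * d\<^sup>2) \<longleftrightarrow> is_rat_norm q (n * idot e e)"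
proof -
  have "idot (c *s a) (c *s a) = idot (M *s a\<^sub>0) (M *s a\<^sub>0)"
    unfolding idot_linear a(1) a\<^sub>0(1) by (simp add: power2_eq_square)
  moreover have "idot e (M *s a\<^sub>0) = 0" using e by (simp add: idot_linear)
  ultimately obtain u s where u: "s \<noteq> 0" "idot u (c *s a) = 0" "idot u u = idot e e * s\<^sup>2"
    using reflected_orthogonal by metis
  have "idot u a = 0" using u(2) a\<^sub>0(2) by (simp add: idot_linear)
  moreover have "u \<noteq> 0"
    using u(1,3) e(2) idot_self_eq_0_iff[of u] idot_self_eq_0_iff[of e] by simp
  ultimately have "(\<exists>w d. d \<noteq> 0 \<and> idot w a = 0 \<and> idot w w = n * d\<^sup>2) \<longleftrightarrow> is_rat_norm q (n * idot u u)"
    by (intro orthogonal_represents_iff_is_rat_norm[OF a])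
  also have "\<dots> \<longleftrightarrow> is_rat_norm q (n * idot e e)"
    using is_rat_norm_mult_square_iff[OF u(1), of q "n * idot e e"] unfolding u(3) by (simp add: mult.assoc)
  finally show ?thesis .
qed

text \<open>The model vector \<open>(x, y, 0)\<close> is orthogonal to a unit vector, so no extra
  factor appears.\<close>

lemma orthogonal_represents_iff_sum_squares:
  fixes q M n :: int
  assumes a: "idot a a = q * M\<^sup>2" "q \<noteq> 0" "M \<noteq> 0" and q: "is_rat_norm 1 q"
  shows "(\<exists>w d. d \<noteq> 0 \<and> idot w a = 0 \<and> idot w w = n * d\<^sup>2) \<longleftrightarrow> is_rat_norm q n"
proof -
  obtain x y z where xyz: "z \<noteq> 0" "x\<^sup>2 + y\<^sup>2 = q * z\<^sup>2" using q by (auto simp: is_rat_norm_def)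
  define a\<^sub>0 :: "int ^ 3" where "a\<^sub>0 = vector [x, y, 0]"
  define e :: "int ^ 3" where "e = vector [0, 0, 1]"
  have "idot a\<^sub>0 a\<^sub>0 = q * z\<^sup>2" "idot e a\<^sub>0 = 0" and e1: "idot e e = 1"
    using xyz(2) by (simp_all add: a\<^sub>0_def e_def idot_expand power2_eq_square)
  moreover have "e \<noteq> 0" using e1 idot_self_eq_0_iff[of e] by auto
  ultimately show ?thesis
    using orthogonal_represents_iff[OF a, of a\<^sub>0 z e n] xyz(1) by simp
qed

text \<open>The model vector is \<open>(x, y, y)\<close>; the orthogonal vector
  \<open>(0, 1, -1)\<close> has squared length 2, whence the factor 2.\<close>

lemma orthogonal_represents_iff_square_plus_twice_square:
  fixes q M n :: int
  assumes a: "idot a a = q * M\<^sup>2" "q \<noteq> 0" "M \<noteq> 0" and q: "is_rat_norm 2 q"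
  shows "(\<exists>w d. d \<noteq> 0 \<and> idot w a = 0 \<and> idot w w = n * d\<^sup>2) \<longleftrightarrow> is_rat_norm q (2 * n)"
proof -
  obtain x y z where xyz: "z \<noteq> 0" "x\<^sup>2 + 2 * y\<^sup>2 = q * z\<^sup>2" using q by (auto simp: is_rat_norm_def)
  define a\<^sub>0 :: "int ^ 3" where "a\<^sub>0 = vector [x, y, y]"
  define e :: "int ^ 3" where "e = vector [0, 1, -1]"
  have "idot a\<^sub>0 a\<^sub>0 = q * z\<^sup>2" "idot e a\<^sub>0 = 0" and e1: "idot e e = 2"
    using xyz(2) by (simp_all add: a\<^sub>0_def e_def idot_expand power2_eq_square)
  moreover have "e \<noteq> 0" using e1 idot_self_eq_0_iff[of e] by auto
  ultimately show ?thesis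
    using orthogonal_represents_iff[OF a, of a\<^sub>0 z e n] xyz(1) by (simp add: mult.commute)
qed

section \<open>From angles to orthogonal integer vectors\<close>

lemma inner_real_vec: "real_vec v \<bullet> real_vec w = real_of_int (idot v w)"
  by (simp add: inner_vec_def real_vec_def idot_def)

lemma norm_real_vec_power2: "(norm (real_vec v))\<^sup>2 = real_of_int (idot v v)"
  by (simp add: power2_norm_eq_inner inner_real_vec)

lemma real_vec_eq_0_iff: "real_vec v = 0 \<longleftrightarrow> v = 0"
  by (simp add: real_vec_def vec_eq_iff)

lemma tan_power2_mult_cos_power2:
  fixes \<theta> :: real
  assumes "cos \<theta> \<noteq> 0"
  shows "(tan \<theta>)\<^sup>2 * (cos \<theta>)\<^sup>2 = 1 - (cos \<theta>)\<^sup>2"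
  using assms by (simp add: tan_def power_divide sin_squared_eq)

lemma cos_neq_0:
  fixes \<theta> :: real
  assumes "0 < \<theta>" "\<theta> < pi" "\<theta> \<noteq> pi / 2"
  shows "cos \<theta> \<noteq> 0"
  using assms arccos_cos[of \<theta>] by (metis arccos_0 less_eq_real_def)

lemma tan_power2_pos:
  fixes \<theta> :: real
  assumes "0 < \<theta>" "\<theta> < pi" "\<theta> \<noteq> pi / 2"
  shows "(tan \<theta>)\<^sup>2 > 0"
  using cos_neq_0[OF assms] sin_gt_zero[OF assms(1,2)] by (simp add: tan_def)

text \<open>From \<open>b\<close> take \<open>w = a \<times> b\<close> and \<open>d = a \<bullet> b\<close>; conversely, \<open>b = d a + a \<times> w\<close>, where the sign of
  \<open>d\<close> is that of \<open>cos \<theta>\<close>, makes the angle \<open>\<theta>\<close> with \<open>a\<close>.\<close>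

lemma mem_Theta3_iff:
  fixes a :: "int ^ 3" and \<theta> :: real
  assumes a: "a \<noteq> 0" and \<theta>: "0 < \<theta>" "\<theta> < pi" "\<theta> \<noteq> pi / 2"
  shows "\<theta> \<in> Theta3 a \<longleftrightarrow>
    (\<exists>w d. d \<noteq> 0 \<and> idot w a = 0 \<and> real_of_int (idot w w) = (tan \<theta>)\<^sup>2 * (real_of_int d)\<^sup>2)"
    (is "_ \<longleftrightarrow> ?rhs")
proof
  note cos = cos_neq_0[OF \<theta>]
  note tan = tan_power2_mult_cos_power2[OF cos]
  {
    assume "\<theta> \<in> Theta3 a"
    then obtain b where b: "b \<noteq> 0" "\<theta> = vec_angle (real_vec a) (real_vec b)"
      by (auto simp: Theta3_def)
    define P where "P = norm (real_vec a) * norm (real_vec b)"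
    have "P > 0" using a b(1) by (simp add: P_def real_vec_eq_0_iff)
    have "\<bar>real_of_int (idot a b)\<bar> \<le> P"
      using Cauchy_Schwarz_ineq2[of "real_vec a" "real_vec b"] by (simp add: P_def inner_real_vec)
    then have "\<bar>real_of_int (idot a b) / P\<bar> \<le> 1" using \<open>P > 0\<close> by simp
    then have "cos \<theta> = real_of_int (idot a b) / P"
      unfolding b(2) vec_angle_def P_def inner_real_vec by (simp only: cos_arccos_abs)
    then have P: "cos \<theta> * P = real_of_int (idot a b)" using \<open>P > 0\<close> by simp
    have P2: "P\<^sup>2 = real_of_int (idot a a * idot b b)"
      by (simp add: P_def power_mult_distrib norm_real_vec_power2)
    define w where "w = icross a b"
    have "real_of_int (idot w w) = P\<^sup>2 - (cos \<theta> * P)\<^sup>2"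
      unfolding w_def idot_icross_icross P2 P by simp
    also have "\<dots> = (1 - (cos \<theta>)\<^sup>2) * P\<^sup>2" by (simp add: algebra_simps power_mult_distrib)
    also have "\<dots> = (tan \<theta>)\<^sup>2 * (cos \<theta> * P)\<^sup>2"
      unfolding tan[symmetric] by (simp add: power_mult_distrib)
    finally have "real_of_int (idot w w) = (tan \<theta>)\<^sup>2 * (real_of_int (idot a b))\<^sup>2"
      unfolding P .
    moreover have "idot w a = 0" by (simp add: w_def idot_commute[of _ a])
    moreover have "idot a b \<noteq> 0" using P cos \<open>P > 0\<close> by auto
    ultimately show ?rhs by blast
  }
  {
    assume ?rhs
    then obtain w d where w: "d \<noteq> 0" "idot w a = 0"
      "real_of_int (idot w w) = (tan \<theta>)\<^sup>2 * (real_of_int d)\<^sup>2" by blast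
    define d' where "d' = (if cos \<theta> > 0 then \<bar>d\<bar> else - \<bar>d\<bar>)"
    define b where "b = d' *s a + icross a w"
    define A where "A = real_of_int (idot a a)"
    have "A > 0"
    proof -
      have "idot a a \<noteq> 0" using a by (simp add: idot_self_eq_0_iff)
      moreover have "idot a a \<ge> 0" by (simp add: idot_def sum_nonneg)
      ultimately show ?thesis by (simp add: A_def)
    qed
    have ab: "real_of_int (idot a b) = real_of_int d' * A"
      unfolding b_def idot_linear A_def by simp
    have "idot b b = d'\<^sup>2 * idot a a + idot a a * idot w w"
      unfolding b_def idot_linear idot_icross_icross
      using w(2) by (simp add: idot_commute[of "icross a w" a] idot_commute[of a w] power2_eq_square)
    then have "real_of_int (idot b b) = A * (real_of_int d)\<^sup>2 * (1 + (tan \<theta>)\<^sup>2)"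
      using w(3) by (simp add: A_def d'_def algebra_simps)
    \<comment> \<open>Multiplying by the squared cosine removes the tangent, as the last factor
      equals 1.\<close>
    then have "real_of_int (idot b b) * (cos \<theta>)\<^sup>2 = A * (real_of_int d)\<^sup>2 * ((cos \<theta>)\<^sup>2 + (tan \<theta>)\<^sup>2 * (cos \<theta>)\<^sup>2)"
      by (simp add: algebra_simps)
    then have bb: "real_of_int (idot b b) * (cos \<theta>)\<^sup>2 = A * (real_of_int d)\<^sup>2"
      unfolding tan by simp
    have "b \<noteq> 0"
      using bb \<open>A > 0\<close> w(1) by (auto simp: idot_def)
    define P where "P = norm (real_vec a) * norm (real_vec b)"
    have "P > 0" using a \<open>b \<noteq> 0\<close> by (simp add: P_def real_vec_eq_0_iff)
    have "(P * \<bar>cos \<theta>\<bar>)\<^sup>2 = A * (real_of_int (idot b b) * (cos \<theta>)\<^sup>2)"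
      by (simp add: P_def power_mult_distrib norm_real_vec_power2 A_def mult.assoc)
    also have "\<dots> = (A * \<bar>real_of_int d\<bar>)\<^sup>2"
      unfolding bb by (simp add: power_mult_distrib) (simp add: power2_eq_square)
    finally have Pcos: "P * \<bar>cos \<theta>\<bar> = A * \<bar>real_of_int d\<bar>"
      by (rule power2_eq_imp_eq) (use \<open>P > 0\<close> \<open>A > 0\<close> in auto)
    have "real_of_int (idot a b) = cos \<theta> * P"
    proof (cases "cos \<theta> > 0")
      case True
      then show ?thesis using Pcos unfolding ab d'_def by (simp add: mult.commute)
    next
      case False
      then show ?thesis using Pcos unfolding ab d'_def by (simp add: mult.commute)
    qed
    then have "(real_vec a \<bullet> real_vec b) / P = cos \<theta>"
      using \<open>P > 0\<close> by (simp add: inner_real_vec)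
    then have "vec_angle (real_vec a) (real_vec b) = \<theta>"
      unfolding vec_angle_def P_def using \<theta> arccos_cos[of \<theta>] by simp
    then show "\<theta> \<in> Theta3 a" using \<open>b \<noteq> 0\<close> unfolding Theta3_def by blast
  }
qed

text \<open>Minimality gives square-freeness: a factor \<open>c\<^sup>2\<close> of the value could
  be absorbed into the rational square, leaving a smaller candidate. The second claim clears the
  denominators.\<close>

lemma rat_squarefree_part_properties:
  assumes "X \<in> \<rat>" "X > 0"
  shows "squarefree (rat_squarefree_part X)"
    and "\<exists>m n :: int. m \<noteq> 0 \<and> n \<noteq> 0 \<and>
      X * (real_of_int n)\<^sup>2 = real (rat_squarefree_part X) * (real_of_int m)\<^sup>2"
proof -
  define P where "P = (\<lambda>N. N > 0 \<and> (\<exists>r\<in>\<rat>. X / real N = r\<^sup>2))"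
  define N where "N = rat_squarefree_part X"
  have N_Least: "N = (LEAST N. P N)"
    unfolding N_def rat_squarefree_part_def P_def ..
  obtain i j :: int where ij: "j > 0" "X = real_of_int i / real_of_int j"
    using assms(1) by (elim Rats_cases')
  then have "i > 0" using assms(2) by (simp add: zero_less_divide_iff)
  \<comment> \<open>For \<open>X = i / j\<close> the number \<open>i * j\<close> is a candidate, so
    \<open>LEAST\<close> ranges over a nonempty set.\<close>
  have "P (nat (i * j))"
  proof -
    have "X / real (nat (i * j)) = (1 / real_of_int j)\<^sup>2"
      using ij \<open>i > 0\<close> by (simp add: power2_eq_square field_simps)
    moreover have "1 / real_of_int j \<in> \<rat>" by simp
    ultimately show ?thesis using ij \<open>i > 0\<close> unfolding P_def by fastforce
  qed
  then have "P N" unfolding N_Least by (rule LeastI)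
  then obtain r where r: "r \<in> \<rat>" "X / real N = r\<^sup>2" and N: "N > 0" unfolding P_def by blast
  obtain m n :: int where mn: "n > 0" "r = real_of_int m / real_of_int n"
    using r(1) by (elim Rats_cases')
  have "m \<noteq> 0" using r(2) mn N assms(2) by auto
  moreover have "X * (real_of_int n)\<^sup>2 = real N * (real_of_int m)\<^sup>2"
    using r(2) mn N by (simp add: power_divide field_simps)
  ultimately show "\<exists>m n :: int. m \<noteq> 0 \<and> n \<noteq> 0 \<and>
      X * (real_of_int n)\<^sup>2 = real (rat_squarefree_part X) * (real_of_int m)\<^sup>2"
    using mn(1) unfolding N_def[symmetric] by (metis less_irrefl)
  show "squarefree (rat_squarefree_part X)"
    unfolding N_def[symmetric] squarefree_def
  proof (intro allI impI)
    fix c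
    assume "c\<^sup>2 dvd N"
    then obtain N' where N': "N = c\<^sup>2 * N'" by blast
    have pos: "c > 0" "N' > 0" using N N' by (auto intro: Nat.gr0I)
    have "X / real N' = (r * real c)\<^sup>2"
      using r(2) pos unfolding N' by (simp add: power_mult_distrib field_simps)
    then have "P N'" using r(1) pos unfolding P_def by (metis Rats_mult Rats_of_nat)
    then have "N \<le> N'" unfolding N_Least by (rule Least_le)
    then have "c\<^sup>2 * N' \<le> 1 * N'" unfolding N' by simp
    then have "c\<^sup>2 \<le> 1" using pos by simp
    then have "c = 1" using pos power2_nat_le_eq_le[of c 1] by simp
    then show "is_unit c" by simp
  qed
qed

text \<open>The squared tangent and its square-free part differ by the square of
  \<open>m / n\<close>, which rescaling \<open>w\<close> and \<open>d\<close> absorbs.\<close>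

lemma mem_Theta3_iff_squarefree_part:
  fixes a :: "int ^ 3" and \<theta> :: real
  assumes a: "a \<noteq> 0" and \<theta>: "0 < \<theta>" "\<theta> < pi" "\<theta> \<noteq> pi / 2" and rat: "(tan \<theta>)\<^sup>2 \<in> \<rat>"
  shows "\<theta> \<in> Theta3 a \<longleftrightarrow> (\<exists>w d. d \<noteq> 0 \<and> idot w a = 0 \<and>
    idot w w = int (rat_squarefree_part ((tan \<theta>)\<^sup>2)) * d\<^sup>2)" (is "_ \<longleftrightarrow> ?rhs")
proof -
  define X where "X = (tan \<theta>)\<^sup>2"
  define N where "N = rat_squarefree_part X"
  have "X > 0" unfolding X_def by (rule tan_power2_pos[OF \<theta>])
  then obtain m n :: int where mn: "m \<noteq> 0" "n \<noteq> 0"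
    "X * (real_of_int n)\<^sup>2 = real N * (real_of_int m)\<^sup>2"
    using rat_squarefree_part_properties(2)[of X] rat unfolding X_def N_def by blast
  have "(\<exists>w d. d \<noteq> 0 \<and> idot w a = 0 \<and> real_of_int (idot w w) = X * (real_of_int d)\<^sup>2) \<longleftrightarrow>
    (\<exists>w d. d \<noteq> 0 \<and> idot w a = 0 \<and> idot w w = int N * d\<^sup>2)" (is "?l \<longleftrightarrow> ?r")
  proof
    assume ?l
    then obtain w d where w: "d \<noteq> 0" "idot w a = 0"
      "real_of_int (idot w w) = X * (real_of_int d)\<^sup>2" by blast
    have "real_of_int (idot (n *s w) (n *s w)) = (X * (real_of_int n)\<^sup>2) * (real_of_int d)\<^sup>2"
      unfolding idot_linear using w(3) by (simp add: power2_eq_square)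
    also have "\<dots> = real_of_int (int N * (m * d)\<^sup>2)"
      unfolding mn(3) by (simp add: power_mult_distrib)
    finally have "idot (n *s w) (n *s w) = int N * (m * d)\<^sup>2" by (simp only: of_int_eq_iff)
    moreover have "m * d \<noteq> 0" "idot (n *s w) a = 0"
      using mn w by (simp_all add: idot_linear)
    ultimately show ?r by blast
  next
    assume ?r
    then obtain w d where w: "d \<noteq> 0" "idot w a = 0" "idot w w = int N * d\<^sup>2" by blast
    have "real_of_int (idot (m *s w) (m *s w)) = (real N * (real_of_int m)\<^sup>2) * (real_of_int d)\<^sup>2"
      unfolding idot_linear w(3) by (simp add: power2_eq_square)
    also have "\<dots> = X * (real_of_int (n * d))\<^sup>2"
      unfolding mn(3)[symmetric] by (simp add: power_mult_distrib)
    finally have "real_of_int (idot (m *s w) (m *s w)) = X * (real_of_int (n * d))\<^sup>2" .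
    moreover have "n * d \<noteq> 0" "idot (m *s w) a = 0"
      using mn w by (simp_all add: idot_linear)
    ultimately show ?l by blast
  qed
  then show ?thesis
    unfolding mem_Theta3_iff[OF a \<theta>] X_def N_def .
qed

section \<open>The characterisation of the angles\<close>

text \<open>For odd \<open>m\<close> the right-hand side is 7 modulo 8, which is not a sum of three
  of the residues 0, 1, 4. For even \<open>m\<close> the sum is divisible by 4, so all three numbers
  are even, and halving gives a descent.\<close>

lemma sum_three_squares_7_mod_8:
  fixes x y z q m :: int
  assumes "q mod 8 = 7" "x\<^sup>2 + y\<^sup>2 + z\<^sup>2 = q * m\<^sup>2"
  shows "m = 0"
  using assms(2)
proof (induction "nat \<bar>m\<bar>" arbitrary: x y z m rule: less_induct)
  case less
  obtain l where l: "q = 8 * l + 7" using assms(1) by (metis mult_div_mod_eq)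
  have sq_mod_8: "v\<^sup>2 mod 8 \<in> {0, 1, 4}" for v :: int
  proof (cases "even v")
    case True
    then obtain i where i: "v = 2 * i" by (elim evenE)
    show ?thesis
    proof (cases "even i")
      case True
      then obtain j where "i = 2 * j" by (elim evenE)
      then have "v\<^sup>2 = 8 * (2 * j\<^sup>2)" using i by (simp add: power_mult_distrib)
      then show ?thesis by simp
    next
      case False
      then obtain j where "i\<^sup>2 = 8 * j + 1" using odd_power2_mod_8 by (metis mult_div_mod_eq)
      then have "v\<^sup>2 = 32 * j + 4" using i by (simp add: power_mult_distrib)
      moreover have "(32 * j + 4) mod 8 = 4" by presburger
      ultimately show ?thesis by simp
    qed
  qed (use odd_power2_mod_8 in blast)
  have mod_add3: "(u mod k + v mod k + w mod k) mod k = (u + v + w) mod k" for u v w k :: int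
    unfolding cong_def[symmetric] by (intro cong_add) (simp_all add: cong_def)
  show ?case
  proof (cases "even m")
    case True
    then obtain m' where m': "m = 2 * m'" by (elim evenE)
    have eq: "x\<^sup>2 + y\<^sup>2 + z\<^sup>2 = 4 * (q * m'\<^sup>2)" using less.prems m' by (simp add: power_mult_distrib)
    have mod4: "v\<^sup>2 mod 4 = (if even v then 0 else 1)" for v :: int
    proof (cases "even v")
      case True
      then show ?thesis by (auto elim!: evenE simp: power_mult_distrib)
    next
      case False
      then obtain j where "v\<^sup>2 = 8 * j + 1" using odd_power2_mod_8 by (metis mult_div_mod_eq)
      moreover have "(8 * j + 1) mod 4 = 1" by presburger
      ultimately show ?thesis using False by simp
    qed
    have "(x\<^sup>2 mod 4 + y\<^sup>2 mod 4 + z\<^sup>2 mod 4) mod 4 = (x\<^sup>2 + y\<^sup>2 + z\<^sup>2) mod 4"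
      by (rule mod_add3)
    then have "(x\<^sup>2 mod 4 + y\<^sup>2 mod 4 + z\<^sup>2 mod 4) mod 4 = 0" unfolding eq by simp
    then have "even x" "even y" "even z" unfolding mod4 by (simp_all split: if_splits)
    then obtain x' y' z' where xyz': "x = 2 * x'" "y = 2 * y'" "z = 2 * z'" by (elim evenE)
    then have "x'\<^sup>2 + y'\<^sup>2 + z'\<^sup>2 = q * m'\<^sup>2" using eq by (simp add: power_mult_distrib)
    moreover have "nat \<bar>m'\<bar> < nat \<bar>m\<bar>" if "m \<noteq> 0" using that m' by simp
    ultimately show ?thesis using less.hyps m' by fastforce
  next
    case False
    then obtain j where j: "m\<^sup>2 = 8 * j + 1" using odd_power2_mod_8 by (metis mult_div_mod_eq)
    have "x\<^sup>2 + y\<^sup>2 + z\<^sup>2 = 8 * (8 * l * j + l + 7 * j) + 7"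
      unfolding less.prems l j by (simp add: algebra_simps)
    moreover have "(x\<^sup>2 mod 8 + y\<^sup>2 mod 8 + z\<^sup>2 mod 8) mod 8 = (x\<^sup>2 + y\<^sup>2 + z\<^sup>2) mod 8"
      by (rule mod_add3)
    moreover have "(8 * t + 7) mod 8 = 7" for t :: int by presburger
    ultimately have "(x\<^sup>2 mod 8 + y\<^sup>2 mod 8 + z\<^sup>2 mod 8) mod 8 = 7" by (simp only:)
    then show ?thesis
      using sq_mod_8[of x] sq_mod_8[of y] sq_mod_8[of z] by (elim insertE) simp_all
  qed
qed

theorem theorem3p2:
  fixes a :: "int ^ 3" and M :: int and \<theta> :: real and N :: nat
  assumes a_nonzero: "a \<noteq> 0"
    and theta_range: "0 < \<theta>" "\<theta> < pi" "\<theta> \<noteq> pi / 2"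
    and tan_rational: "(tan \<theta>)\<^sup>2 \<in> \<rat>"
    and N_def: "N = rat_squarefree_part ((tan \<theta>)\<^sup>2)"
  shows
    "((norm (real_vec a))\<^sup>2 = (real_of_int M)\<^sup>2 \<longrightarrow>
        (\<theta> \<in> Theta3 a \<longleftrightarrow>
          (\<exists>b \<in> {0, 1 :: nat}. \<exists>ps :: nat list.
             N = 2 ^ b * prod_list ps \<and>
             (\<forall>p \<in> set ps. prime p \<and> odd p \<and> p mod 4 = 1))))
     \<and>
     ((norm (real_vec a))\<^sup>2 = 2 * (real_of_int M)\<^sup>2 \<longrightarrow>
        (\<theta> \<in> Theta3 a \<longleftrightarrow>
          (\<exists>b \<in> {0, 1 :: nat}. \<exists>ps :: nat list.
             N = 2 ^ b * prod_list ps \<and>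
             (\<forall>p \<in> set ps. prime p \<and> odd p \<and> (p mod 8 = 1 \<or> p mod 8 = 3)))))
     \<and>
     (\<forall>q :: nat. prime q \<longrightarrow> odd q \<longrightarrow>
        (norm (real_vec a))\<^sup>2 = real q * (real_of_int M)\<^sup>2 \<longrightarrow>
        (q mod 8 = 3 \<longrightarrow>
           (\<theta> \<in> Theta3 a \<longleftrightarrow>
             (\<exists>b' \<in> {0, 1 :: nat}. \<exists>ps :: nat list.
                N = 2 * q ^ b' * prod_list ps \<and>
                (\<forall>p \<in> set ps. prime p \<and> odd p \<and> Legendre (int p) (int q) = 1))))
        \<and>
        (q mod 8 = 1 \<longrightarrow>
           (\<theta> \<in> Theta3 a \<longleftrightarrow>
             (\<exists>b \<in> {0, 1 :: nat}. \<exists>b' \<in> {0, 1 :: nat}. \<exists>ps :: nat list.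
                N = 2 ^ b * q ^ b' * prod_list ps \<and>
                (\<forall>p \<in> set ps. prime p \<and> odd p \<and>
                   Legendre (int p) (int q) = (-1) ^ ((p - 1) div 2)) \<and>
                even ((prod_list ps - 1) div 2))))
        \<and>
        (q mod 8 = 5 \<longrightarrow>
           (\<theta> \<in> Theta3 a \<longleftrightarrow>
             (\<exists>b' \<in> {0, 1 :: nat}. \<exists>ps :: nat list.
                N = q ^ b' * prod_list ps \<and>
                (\<forall>p \<in> set ps. prime p \<and> odd p \<and>
                   Legendre (int p) (int q) = (-1) ^ ((p - 1) div 2)) \<and>
                even ((prod_list ps - 1) div 2))
             \<or>
             (\<exists>b' \<in> {0, 1 :: nat}. \<exists>ps :: nat list.
                N = 2 * q ^ b' * prod_list ps \<and>
                (\<forall>p \<in> set ps. prime p \<and> odd p \<and>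
                   Legendre (int p) (int q) = (-1) ^ ((p - 1) div 2)) \<and>
                odd ((prod_list ps - 1) div 2))))
        \<and>
        q mod 8 \<noteq> 7)"
proof -
  have Theta: "\<theta> \<in> Theta3 a \<longleftrightarrow> (\<exists>w d. d \<noteq> 0 \<and> idot w a = 0 \<and> idot w w = int N * d\<^sup>2)"
    unfolding N_def by (rule mem_Theta3_iff_squarefree_part[OF a_nonzero theta_range tan_rational])
  have sf: "squarefree N"
    unfolding N_def using tan_rational tan_power2_pos[OF theta_range]
    by (rule rat_squarefree_part_properties(1))
  \<comment> \<open>Stated for general \<open>k\<close> to serve 1, 2 and \<open>q\<close> alike;
    \<open>M\<close> cannot vanish because \<open>a\<close> does not.\<close>
  have norm_eq: "idot a a = int k * M\<^sup>2" "M \<noteq> 0"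
    if "(norm (real_vec a))\<^sup>2 = real k * (real_of_int M)\<^sup>2" for k
  proof -
    have "real_of_int (idot a a) = real_of_int (int k * M\<^sup>2)"
      using that unfolding norm_real_vec_power2 by simp
    then show "idot a a = int k * M\<^sup>2" by (simp only: of_int_eq_iff)
    then show "M \<noteq> 0" using a_nonzero idot_self_eq_0_iff[of a] by auto
  qed
  have case1: "\<theta> \<in> Theta3 a \<longleftrightarrow>
      (\<exists>b \<in> {0, 1 :: nat}. \<exists>ps. N = 2 ^ b * prod_list ps \<and>
        (\<forall>p \<in> set ps. prime p \<and> odd p \<and> p mod 4 = 1))"
    if "(norm (real_vec a))\<^sup>2 = (real_of_int M)\<^sup>2"
  proof -
    have "\<theta> \<in> Theta3 a \<longleftrightarrow> is_rat_norm (int 1) (int N)"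
      unfolding Theta using norm_eq[of 1] that
      by (intro orthogonal_represents_iff_sum_squares) simp_all
    moreover have "(prime p \<and> odd p \<and> Legendre (- int 1) (int p) = 1) \<longleftrightarrow>
        (prime p \<and> odd p \<and> p mod 4 = 1)" for p
      using Legendre_minus_one_eq_1_iff[of p] by auto
    ultimately show ?thesis
      using is_rat_norm_1_or_2_iff[OF sf, of 1] by (simp only: insert_iff simp_thms)
  qed
  have case2: "\<theta> \<in> Theta3 a \<longleftrightarrow>
      (\<exists>b \<in> {0, 1 :: nat}. \<exists>ps. N = 2 ^ b * prod_list ps \<and>
        (\<forall>p \<in> set ps. prime p \<and> odd p \<and> (p mod 8 = 1 \<or> p mod 8 = 3)))"
    if "(norm (real_vec a))\<^sup>2 = 2 * (real_of_int M)\<^sup>2"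
  proof -
    have "\<theta> \<in> Theta3 a \<longleftrightarrow> is_rat_norm (int 2) (int N)"
      unfolding Theta using norm_eq[of 2] that is_rat_norm_1_2
      by (intro orthogonal_represents_iff_sum_squares) simp_all
    moreover have "(prime p \<and> odd p \<and> Legendre (- int 2) (int p) = 1) \<longleftrightarrow>
        (prime p \<and> odd p \<and> (p mod 8 = 1 \<or> p mod 8 = 3))" for p
      using Legendre_minus_two_eq_1_iff[of p] by auto
    ultimately show ?thesis
      using is_rat_norm_1_or_2_iff[OF sf, of 2] by (simp only: insert_iff simp_thms)
  qed
  have case3: "\<theta> \<in> Theta3 a \<longleftrightarrow>
      (\<exists>b' \<in> {0, 1 :: nat}. \<exists>ps. N = 2 * q ^ b' * prod_list ps \<and>
        (\<forall>p \<in> set ps. prime p \<and> odd p \<and> Legendre (int p) (int q) = 1))"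
    if q: "prime q" "odd q" "(norm (real_vec a))\<^sup>2 = real q * (real_of_int M)\<^sup>2" "q mod 8 = 3" for q
  proof -
    \<comment> \<open>For \<open>q\<close> congruent to 3 modulo 8 the number \<open>-2\<close> is a
      residue modulo \<open>q\<close>, which gives the model vector of shape
      \<open>(x, y, y)\<close>.\<close>
    have "is_rat_norm 2 (int q)"
      using is_rat_norm_odd_prime[OF q(1,2), of 2] Legendre_minus_two_eq_1_iff[OF q(1,2)] q(4) by simp
    then have "\<theta> \<in> Theta3 a \<longleftrightarrow> is_rat_norm (int q) (2 * int N)"
      unfolding Theta using norm_eq[OF q(3)] q(1)
      by (intro orthogonal_represents_iff_square_plus_twice_square) auto
    then show ?thesis
      unfolding is_rat_norm_twice_prime_3_mod_8_iff[OF q(1,4) sf] .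
  qed
  have case4: "\<theta> \<in> Theta3 a \<longleftrightarrow>
      (\<exists>b \<in> {0, 1 :: nat}. \<exists>b' \<in> {0, 1 :: nat}. \<exists>ps. N = 2 ^ b * q ^ b' * prod_list ps \<and>
        (\<forall>p \<in> set ps. prime p \<and> odd p \<and> Legendre (int p) (int q) = (-1) ^ ((p - 1) div 2)) \<and>
        Legendre 2 (int q) ^ b * (-1) ^ ((prod_list ps - 1) div 2) = 1)"
    if q: "prime q" "odd q" "(norm (real_vec a))\<^sup>2 = real q * (real_of_int M)\<^sup>2" "q mod 4 = 1" for q
  proof -
    \<comment> \<open>Here \<open>-1\<close> is a residue modulo \<open>q\<close>, so
      \<open>q\<close> is a sum of two rational squares.\<close>
    have "is_rat_norm 1 (int q)"
      using is_rat_norm_odd_prime[OF q(1,2), of 1] Legendre_minus_one_eq_1_iff[OF q(1,2)] q(4) by simp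
    then have "\<theta> \<in> Theta3 a \<longleftrightarrow> is_rat_norm (int q) (int N)"
      unfolding Theta using norm_eq[OF q(3)] q(1)
      by (intro orthogonal_represents_iff_sum_squares) auto
    then show ?thesis
      unfolding is_rat_norm_prime_1_mod_4_iff[OF q(1,4) sf] .
  qed
  have not7: "q mod 8 \<noteq> 7"
    if "(norm (real_vec a))\<^sup>2 = real q * (real_of_int M)\<^sup>2" for q :: nat
  proof
    assume "q mod 8 = 7"
    then have "int q mod 8 = 7" by (metis of_nat_mod of_nat_numeral)
    moreover have "(a $ 1)\<^sup>2 + (a $ 2)\<^sup>2 + (a $ 3)\<^sup>2 = int q * M\<^sup>2"
      using norm_eq(1)[OF that] by (simp add: idot_expand power2_eq_square)
    ultimately show False using sum_three_squares_7_mod_8 norm_eq(2)[OF that] by blast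
  qed
  have leg2: "Legendre 2 (int q) = (if q mod 8 = 1 \<or> q mod 8 = 7 then 1 else -1)"
    if "prime q" "odd q" for q
    using Legendre_two odd_prime_gt_2 that by blast
  have mod4: "q mod 4 = 1" if "q mod 8 = 1 \<or> q mod 8 = 5" for q :: nat
    using that by presburger
  have sign: "(-1::int) ^ k = 1 \<longleftrightarrow> even k" "(-1::int) * (-1) ^ k = 1 \<longleftrightarrow> odd k" for k :: nat
    by (simp_all add: minus_one_power_iff)
  show ?thesis
  proof (intro conjI allI impI)
    fix q :: nat
    assume q: "prime q" "odd q" "(norm (real_vec a))\<^sup>2 = real q * (real_of_int M)\<^sup>2" "q mod 8 = 1"
    show "\<theta> \<in> Theta3 a \<longleftrightarrow>
       (\<exists>b \<in> {0, 1 :: nat}. \<exists>b' \<in> {0, 1 :: nat}. \<exists>ps :: nat list.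
          N = 2 ^ b * q ^ b' * prod_list ps \<and>
          (\<forall>p \<in> set ps. prime p \<and> odd p \<and>
             Legendre (int p) (int q) = (-1) ^ ((p - 1) div 2)) \<and>
          even ((prod_list ps - 1) div 2))"
    proof -
      have leg: "Legendre 2 (int q) = 1" using leg2[OF q(1,2)] q(4) by simp
      show ?thesis
        unfolding case4[OF q(1-3) mod4[OF disjI1[OF q(4)]]] leg power_one mult_1 sign ..
    qed
  next
    fix q :: nat
    assume q: "prime q" "odd q" "(norm (real_vec a))\<^sup>2 = real q * (real_of_int M)\<^sup>2" "q mod 8 = 5"
    show "\<theta> \<in> Theta3 a \<longleftrightarrow>
       (\<exists>b' \<in> {0, 1 :: nat}. \<exists>ps :: nat list.
          N = q ^ b' * prod_list ps \<and>
          (\<forall>p \<in> set ps. prime p \<and> odd p \<and>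
             Legendre (int p) (int q) = (-1) ^ ((p - 1) div 2)) \<and>
          even ((prod_list ps - 1) div 2)) \<or>
       (\<exists>b' \<in> {0, 1 :: nat}. \<exists>ps :: nat list.
          N = 2 * q ^ b' * prod_list ps \<and>
          (\<forall>p \<in> set ps. prime p \<and> odd p \<and>
             Legendre (int p) (int q) = (-1) ^ ((p - 1) div 2)) \<and>
          odd ((prod_list ps - 1) div 2))"
    proof -
      \<comment> \<open>As 2 is a non-residue modulo \<open>q\<close>, the value of \<open>b\<close>
        decides the required parity: even for \<open>b = 0\<close> and odd for \<open>b = 1\<close>.
        This produces the two alternatives.\<close>
      have split: "(\<exists>b \<in> {0, 1 :: nat}. \<exists>b' \<in> B. P b b') \<longleftrightarrow> (\<exists>b' \<in> B. P 0 b') \<or> (\<exists>b' \<in> B. P 1 b')"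
        for B :: "nat set" and P by blast
      have leg: "Legendre 2 (int q) = -1" using leg2[OF q(1,2)] q(4) by simp
      show ?thesis
        unfolding case4[OF q(1-3) mod4[OF disjI2[OF q(4)]]] leg split
          power_0 power_one_right mult_1 sign ..
    qed
  qed (use case1 case2 case3 not7 in blast)+
qed

end
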